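(* Assume all weights equal $1$ ($\omega_k=1$ for all $k$). Let $\hat s_M$ be a self-adjoint apparatus operator with non-degenerate spectrum, the apparatus Hilbert space identified with $L^2(\mathbb{R},d\mu(s))$ with $\hat s_M$ acting as multiplication by $s$, let $g\in L^2(\mathbb{R},d\mu)$ be the normalized initial apparatus wavefunction with state $|g\rangle$, and $b_{g,2l}=\int d\mu(s)\,s^{2l}|g(s)|^2$. Let $|\psi\rangle$ be a state of the signal modes, LO modes and systems other than the apparatus, vacuum on the LO modes, and for $\delta\ge0$ put $|\phi_\delta\rangle=e^{-i\hat q_\delta\otimes\hat s_M}(|\psi\rangle\otimes|g\rangle)$. Then \[ \big\||\phi_\delta\rangle-|\phi_0\rangle\big\|^2\le\delta^2\Big(2b_{g,2}\langle\psi|\hat n_{\mathrm{tot}}|\psi\rangle+\tfrac19\delta^2b_{g,6}\langle\psi|\hat q^2|\psi\rangle+\tfrac12 b_{g,4}\Big). \]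
   Context: Let $N\ge1$. Signal modes $a_1,\dots,a_N$ and local-oscillator (LO) modes $b_1,\dots,b_N$ are $2N$ independent bosonic modes with annihilation operators $\hat a_k,\hat b_k$ satisfying the canonical commutation relations, all cross commutators vanishing. $\hat n_{\mathrm{tot}}=\sum_k\hat a_k^\dagger\hat a_k$. Fix $\alpha\in\mathbb{C}^N$ with $\sum_k|\alpha_k|^2=1$; $\hat q=-i\sum_k(\alpha_k\hat a_k^\dagger-\alpha_k^*\hat a_k)$, and for $\delta>0$, $\hat q_\delta=\hat q+\delta\sum_k(\hat a_k^\dagger\hat b_k+\hat b_k^\dagger\hat a_k)$, $\hat q_0=\hat q$. A state is vacuum on the LO modes if it equals $|0\rangle_b\otimes|\chi\rangle$ with $|0\rangle_b$ the vacuum of all $b_k$. Expectations of positive unbounded operators may be $+\infty$. *)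

theory Defs
  imports "HOL-Analysis.Analysis"
begin

text \<open>Concrete Fock-space model.  Signal modes a_k and LO modes b_k are indexed by a
finite type 'n (so N = CARD('n) \<ge> 1).  A basis vector of the Fock space of the 2N modes
tensored with the Hilbert space l2('x) of the remaining (non-apparatus) systems is indexed
by (occupation numbers of a, occupation numbers of b, x).  Vectors are complex functions
on this index set; Hilbert-space vectors are the square-summable ones.\<close>

type_synonym ('n, 'x) vec = "('n \<Rightarrow> nat) \<times> ('n \<Rightarrow> nat) \<times> 'x \<Rightarrow> complex"

definition l2sq :: "('n, 'x) vec \<Rightarrow> ennreal" where
  "l2sq \<psi> = (\<integral>\<^sup>+ j. ennreal ((cmod (\<psi> j))\<^sup>2) \<partial>count_space UNIV)"

definition in_l2 :: "('n, 'x) vec \<Rightarrow> bool" where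
  "in_l2 \<psi> \<longleftrightarrow> l2sq \<psi> < \<infinity>"

definition l2norm :: "('n, 'x) vec \<Rightarrow> real" where
  "l2norm \<psi> = sqrt (enn2real (l2sq \<psi>))"

definition ann :: "'n \<Rightarrow> ('n, 'x) vec \<Rightarrow> ('n, 'x) vec" where
  "ann k \<psi> = (\<lambda>(a, b, x). complex_of_real (sqrt (real (a k + 1))) * \<psi> (a(k := a k + 1), b, x))"

definition cre :: "'n \<Rightarrow> ('n, 'x) vec \<Rightarrow> ('n, 'x) vec" where
  "cre k \<psi> = (\<lambda>(a, b, x). if a k = 0 then 0
      else complex_of_real (sqrt (real (a k))) * \<psi> (a(k := a k - 1), b, x))"

definition annb :: "'n \<Rightarrow> ('n, 'x) vec \<Rightarrow> ('n, 'x) vec" where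
  "annb k \<psi> = (\<lambda>(a, b, x). complex_of_real (sqrt (real (b k + 1))) * \<psi> (a, b(k := b k + 1), x))"

definition creb :: "'n \<Rightarrow> ('n, 'x) vec \<Rightarrow> ('n, 'x) vec" where
  "creb k \<psi> = (\<lambda>(a, b, x). if b k = 0 then 0
      else complex_of_real (sqrt (real (b k))) * \<psi> (a, b(k := b k - 1), x))"

definition qop :: "('n::finite \<Rightarrow> complex) \<Rightarrow> ('n, 'x) vec \<Rightarrow> ('n, 'x) vec" where
  "qop \<alpha> \<psi> = (\<lambda>j. - \<i> * (\<Sum>k\<in>UNIV. \<alpha> k * cre k \<psi> j - cnj (\<alpha> k) * ann k \<psi> j))"

definition qdop :: "('n::finite \<Rightarrow> complex) \<Rightarrow> real \<Rightarrow> ('n, 'x) vec \<Rightarrow> ('n, 'x) vec" where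
  "qdop \<alpha> \<delta> \<psi> = (\<lambda>j. qop \<alpha> \<psi> j
      + complex_of_real \<delta> * (\<Sum>k\<in>UNIV. cre k (annb k \<psi>) j + creb k (ann k \<psi>) j))"

definition finite_vec :: "('n, 'x) vec \<Rightarrow> bool" where
  "finite_vec v \<longleftrightarrow> finite {j. v j \<noteq> 0}"

text \<open>U is the strongly continuous one-parameter unitary group U t = exp(-i t A) generated by
(the self-adjoint closure of) the operator A given on finitely supported vectors (a core):
unitary on l2, group law, strong continuity, and derivative -i A v at t = 0 for finitely
supported v.  By Stone's theorem and essential self-adjointness of q_delta on finite-particle
vectors such a U exists and is unique on l2.\<close>

definition generated_group ::
  "(('n, 'x) vec \<Rightarrow> ('n, 'x) vec) \<Rightarrow> (real \<Rightarrow> ('n, 'x) vec \<Rightarrow> ('n, 'x) vec) \<Rightarrow> bool" where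
  "generated_group A U \<longleftrightarrow>
     (\<forall>t \<psi>. in_l2 \<psi> \<longrightarrow> in_l2 (U t \<psi>) \<and> l2sq (U t \<psi>) = l2sq \<psi>) \<and>
     (\<forall>t \<psi> \<phi> c. in_l2 \<psi> \<longrightarrow> in_l2 \<phi> \<longrightarrow>
         U t (\<lambda>j. c * \<psi> j + \<phi> j) = (\<lambda>j. c * U t \<psi> j + U t \<phi> j)) \<and>
     (\<forall>t \<phi>. in_l2 \<phi> \<longrightarrow> (\<exists>\<psi>. in_l2 \<psi> \<and> U t \<psi> = \<phi>)) \<and>
     (\<forall>\<psi>. in_l2 \<psi> \<longrightarrow> U 0 \<psi> = \<psi>) \<and>
     (\<forall>s t \<psi>. in_l2 \<psi> \<longrightarrow> U (s + t) \<psi> = U s (U t \<psi>)) \<and>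
     (\<forall>\<psi> t0. in_l2 \<psi> \<longrightarrow> ((\<lambda>t. l2norm (\<lambda>j. U t \<psi> j - U t0 \<psi> j)) \<longlongrightarrow> 0) (at t0)) \<and>
     (\<forall>v. finite_vec v \<longrightarrow>
         ((\<lambda>t. l2norm (\<lambda>j. (U t v j - v j) / complex_of_real t + \<i> * A v j)) \<longlongrightarrow> 0) (at 0))"

definition exp_group ::
  "(('n, 'x) vec \<Rightarrow> ('n, 'x) vec) \<Rightarrow> real \<Rightarrow> ('n, 'x) vec \<Rightarrow> ('n, 'x) vec" where
  "exp_group A = (SOME U. generated_group A U)"

definition n_tot_exp :: "('n::finite, 'x) vec \<Rightarrow> ennreal" where
  "n_tot_exp \<psi> = (\<integral>\<^sup>+ j. ennreal (real (\<Sum>k\<in>UNIV. fst j k) * (cmod (\<psi> j))\<^sup>2) \<partial>count_space UNIV)"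

definition q2_exp :: "('n::finite \<Rightarrow> complex) \<Rightarrow> ('n, 'x) vec \<Rightarrow> ennreal" where
  "q2_exp \<alpha> \<psi> = l2sq (qop \<alpha> \<psi>)"

definition vacuum_LO :: "('n, 'x) vec \<Rightarrow> bool" where
  "vacuum_LO \<psi> \<longleftrightarrow> (\<forall>a b x. b \<noteq> (\<lambda>_. 0) \<longrightarrow> \<psi> (a, b, x) = 0)"

definition bmom :: "real measure \<Rightarrow> (real \<Rightarrow> complex) \<Rightarrow> nat \<Rightarrow> ennreal" where
  "bmom \<mu> g l = (\<integral>\<^sup>+ s. ennreal (s ^ (2 * l) * (cmod (g s))\<^sup>2) \<partial>\<mu>)"

text \<open>|| phi_delta - phi_0 ||^2 where phi_delta(s) = exp(-i s q_delta) psi * g(s) in the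
decomposition of the total space as l2-valued L^2(mu).\<close>

definition phi_dist_sq ::
  "('n::finite \<Rightarrow> complex) \<Rightarrow> real \<Rightarrow> real measure \<Rightarrow> (real \<Rightarrow> complex) \<Rightarrow> ('n, 'x) vec \<Rightarrow> ennreal" where
  "phi_dist_sq \<alpha> \<delta> \<mu> g \<psi> = (\<integral>\<^sup>+ s. ennreal ((cmod (g s))\<^sup>2 *
      (l2norm (\<lambda>j. exp_group (qdop \<alpha> \<delta>) s \<psi> j - exp_group (qdop \<alpha> 0) s \<psi> j))\<^sup>2) \<partial>\<mu>)"

end

theory Submission
  imports Defs
begin

text \<open>
Let \<open>H = \<Sum>k. a_k* b_k + b_k* a_k\<close>, so that \<open>q_\<delta> = q + \<delta> H\<close>. On LO-vacuum vectors \<open>H\<close> acts as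
\<open>T = \<Sum>k. b_k* a_k\<close>, and \<open>exp (-i s q)\<close> preserves the LO vacuum. Since \<open>[T, q] = -i \<beta>\<close>, where
\<open>\<beta> = \<Sum>k. \<alpha>_k b_k*\<close> commutes with \<open>q\<close>, we have
\<open>T exp (-i r q) \<psi> = exp (-i r q) (T \<psi> - r \<beta> \<psi>)\<close>; moreover \<open>|T \<psi>|^2 = <n_tot>\<close> and \<open>|\<beta> \<psi>| = |\<psi>|\<close>.
Duhamel's formula then gives
\<open>|(exp (-i s q_\<delta>) - exp (-i s q)) \<psi>| \<le> \<delta> (|s| sqrt <n_tot> + s^2 / 2)\<close>,
and squaring and integrating against \<open>|g|^2 d\<mu>\<close> yields the claim, even without the \<open>q^2\<close> term.

The unitary groups exist because every finitely supported vector is an entire vector of \<open>q_\<delta>\<close>, that is, the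
power series of the exponential converges on it for all times. Hence the Taylor polynomials of
\<open>exp (-i r q) \<psi>\<close>, which are finitely supported, can replace it in the Duhamel argument.
\<close>

subsection \<open>The Hilbert space of square-summable functions\<close>

text \<open>\<open>exp_group\<close> is a choice among the groups that meet a specification, and
  this specification differentiates only at time 0 and only on finitely supported vectors. Hence
  such a group must be constructed before anything about \<open>exp_group\<close> is known, and exp
  (-i r q) \<psi> leaves the space on which the other group is known to be differentiable.

  Convergence for all times is delicate: hopping on m quanta costs a factor of order m while the
  linear terms keep raising m. Charging each of n steps with the worst factor gives n factorial
  times a power, hence convergence for small times only. The generating function of the bounds is
  therefore compared with an explicit supersolution.

  The constants come from the primitive of |T \<psi>| + r |\<beta> \<psi>| and from (x + y)^2 \<le>
  2 x^2 + 2 y^2, which sends |s| sqrt <n_tot> + s^2 / 2 to 2 s^2 <n_tot> + s^4 / 2; integration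
  against |g|^2 turns s^2 and s^4 into b_{g,2} and b_{g,4}.\<close>

typedef 'i ell2 = "{f :: 'i \<Rightarrow> complex. (\<lambda>i. (cmod (f i))\<^sup>2) summable_on UNIV}"
  morphisms coord Abs_ell2
  by (rule exI[of _ "\<lambda>_. 0"]) simp

setup_lifting type_definition_ell2

lemma nonneg_summable_onI:
  fixes f :: "'i \<Rightarrow> real"
  assumes "\<And>i. f i \<ge> 0" "\<And>F. finite F \<Longrightarrow> sum f F \<le> c"
  shows "f summable_on UNIV"
  using assms by (intro nonneg_bdd_above_summable_on bdd_aboveI[of _ c]) auto

lemma square_summable_add:
  fixes f g :: "'i \<Rightarrow> complex"
  assumes "(\<lambda>i. (cmod (f i))\<^sup>2) summable_on UNIV" "(\<lambda>i. (cmod (g i))\<^sup>2) summable_on UNIV"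
  shows "(\<lambda>i. (cmod (f i + g i))\<^sup>2) summable_on UNIV"
proof (rule summable_on_comparison_test)
  show "(\<lambda>i. 2 * (cmod (f i))\<^sup>2 + 2 * (cmod (g i))\<^sup>2) summable_on UNIV"
    by (intro summable_on_add summable_on_cmult_right assms)
  show "(cmod (f i + g i))\<^sup>2 \<le> 2 * (cmod (f i))\<^sup>2 + 2 * (cmod (g i))\<^sup>2" for i
  proof -
    have "(cmod (f i + g i))\<^sup>2 \<le> (cmod (f i) + cmod (g i))\<^sup>2"
      by (intro power_mono norm_triangle_ineq) auto
    also have "\<dots> \<le> 2 * (cmod (f i))\<^sup>2 + 2 * (cmod (g i))\<^sup>2"
      using zero_le_power2[of "cmod (f i) - cmod (g i)"] by (simp add: power2_eq_square algebra_simps)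
    finally show ?thesis .
  qed
qed auto

lemma square_summable_mult:
  fixes f :: "'i \<Rightarrow> complex"
  assumes "(\<lambda>i. (cmod (f i))\<^sup>2) summable_on UNIV"
  shows "(\<lambda>i. (cmod (c * f i))\<^sup>2) summable_on UNIV"
  using summable_on_cmult_right[OF assms, of "(cmod c)\<^sup>2"] by (simp add: norm_mult power_mult_distrib)

text \<open>Polarisation expresses the inner product through three square-summable families.\<close>

lemma square_summable_inner:
  fixes f g :: "'i \<Rightarrow> complex"
  assumes "(\<lambda>i. (cmod (f i))\<^sup>2) summable_on UNIV" "(\<lambda>i. (cmod (g i))\<^sup>2) summable_on UNIV"
  shows "(\<lambda>i. f i \<bullet> g i) summable_on UNIV"
proof -
  have "(\<lambda>i. f i \<bullet> g i) = (\<lambda>i. (1/2) * ((cmod (f i + g i))\<^sup>2 + (-1 * (cmod (f i))\<^sup>2 + -1 * (cmod (g i))\<^sup>2)))"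
    by (simp add: dot_norm fun_eq_iff field_simps)
  moreover have "(\<lambda>i. (1/2) * ((cmod (f i + g i))\<^sup>2 + (-1 * (cmod (f i))\<^sup>2 + -1 * (cmod (g i))\<^sup>2))) summable_on UNIV"
    by (intro summable_on_cmult_right summable_on_add square_summable_add assms)
  ultimately show ?thesis by simp
qed

lemma coord_summable: "(\<lambda>i. (cmod (coord x i))\<^sup>2) summable_on UNIV"
  using coord[of x] by simp

text \<open>The inner product is the real part of the complex one and induces the usual l2 norm. The
  real structure gives access to vector derivatives and the mean value inequality; complex scalars
  return through \<open>cscale\<close>.\<close>

instantiation ell2 :: (type) real_inner
begin

lift_definition zero_ell2 :: "'a ell2" is "\<lambda>_. 0" by simp

lift_definition plus_ell2 :: "'a ell2 \<Rightarrow> 'a ell2 \<Rightarrow> 'a ell2" is "\<lambda>f g i. f i + g i"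
  by (rule square_summable_add)

lift_definition uminus_ell2 :: "'a ell2 \<Rightarrow> 'a ell2" is "\<lambda>f i. - f i" by simp

lift_definition minus_ell2 :: "'a ell2 \<Rightarrow> 'a ell2 \<Rightarrow> 'a ell2" is "\<lambda>f g i. f i - g i"
  using square_summable_add[of _ "\<lambda>i. - _ i"] by simp

lift_definition scaleR_ell2 :: "real \<Rightarrow> 'a ell2 \<Rightarrow> 'a ell2" is "\<lambda>r f i. of_real r * f i"
  by (rule square_summable_mult)

lift_definition inner_ell2 :: "'a ell2 \<Rightarrow> 'a ell2 \<Rightarrow> real" is "\<lambda>f g. infsum (\<lambda>i. f i \<bullet> g i) UNIV" .

definition norm_ell2 :: "'a ell2 \<Rightarrow> real" where "norm_ell2 x = sqrt (inner x x)"
definition sgn_ell2 :: "'a ell2 \<Rightarrow> 'a ell2" where "sgn_ell2 x = inverse (norm x) *\<^sub>R x"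
definition dist_ell2 :: "'a ell2 \<Rightarrow> 'a ell2 \<Rightarrow> real" where "dist_ell2 x y = norm (x - y)"
definition uniformity_ell2 :: "('a ell2 \<times> 'a ell2) filter"
  where "uniformity_ell2 = (INF e\<in>{0<..}. principal {(x, y). dist x y < e})"
definition open_ell2 :: "'a ell2 set \<Rightarrow> bool"
  where "open_ell2 S = (\<forall>x\<in>S. eventually (\<lambda>(x', y). x' = x \<longrightarrow> y \<in> S) uniformity)"

instance
proof
  fix x y z :: "'a ell2" and r s :: real
  show "x + y + z = x + (y + z)" "x + y = y + x" "0 + x = x" "- x + x = 0" "x - y = x + - y"
    by (transfer; simp add: fun_eq_iff algebra_simps)+
  show "r *\<^sub>R (x + y) = r *\<^sub>R x + r *\<^sub>R y" "(r + s) *\<^sub>R x = r *\<^sub>R x + s *\<^sub>R x"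
    "r *\<^sub>R s *\<^sub>R x = (r * s) *\<^sub>R x" "1 *\<^sub>R x = x"
    by (transfer; simp add: fun_eq_iff algebra_simps)+
  show "inner x y = inner y x" by transfer (simp add: inner_commute)
  show "inner (x + y) z = inner x z + inner y z"
    by transfer (simp add: inner_add_left infsum_add square_summable_inner)
  show "inner (r *\<^sub>R x) y = r * inner x y"
    by transfer (simp add: infsum_cmult_right' flip: scaleR_conv_of_real)
  show "0 \<le> inner x x" by transfer (simp add: infsum_nonneg)
  show "(inner x x = 0) = (x = 0)"
  proof
    assume "inner x x = 0"
    then have "coord x i = 0" for i
      using nonneg_infsum_le_0D[of "\<lambda>i. coord x i \<bullet> coord x i" UNIV i]
      by (auto simp: inner_ell2.rep_eq square_summable_inner coord_summable)
    then show "x = 0" by (metis (no_types) coord_inject ext zero_ell2.rep_eq)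
  qed (transfer; simp)
qed (fact norm_ell2_def sgn_ell2_def dist_ell2_def uniformity_ell2_def open_ell2_def)+

end

lemma norm_ell2_sq: "(norm (x :: 'a ell2))\<^sup>2 = infsum (\<lambda>i. (cmod (coord x i))\<^sup>2) UNIV"
  by (simp add: power2_norm_eq_inner inner_ell2.rep_eq)

lemma sum_coord_le:
  assumes "finite F"
  shows "(\<Sum>i\<in>F. (cmod (coord x i))\<^sup>2) \<le> (norm x)\<^sup>2"
  unfolding norm_ell2_sq using assms by (intro finite_sum_le_infsum coord_summable) auto

lemma norm_coord_le: "cmod (coord x i) \<le> norm x"
  using sum_coord_le[of "{i}" x] by (simp add: power2_le_iff_abs_le)

lemma norm_ell2_le:
  assumes "\<And>F. finite F \<Longrightarrow> (\<Sum>i\<in>F. (cmod (coord x i))\<^sup>2) \<le> c\<^sup>2" "0 \<le> c"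
  shows "norm x \<le> c"
  by (rule power2_le_imp_le[OF _ assms(2)])
    (unfold norm_ell2_sq, rule infsum_le_finite_sums[OF coord_summable assms(1)])

text \<open>The limit is taken coordinatewise. The Cauchy bound, restricted to a finite set of
  coordinates, survives this limit with a constant independent of the set, which gives both
  membership in l2 and convergence in norm.\<close>

instance ell2 :: (type) complete_space
proof
  fix X :: "nat \<Rightarrow> 'a ell2"
  assume "Cauchy X"
  have "Cauchy (\<lambda>n. coord (X n) i)" for i
  proof (rule CauchyI)
    fix e :: real assume "e > 0"
    then obtain M where M: "\<forall>m\<ge>M. \<forall>n\<ge>M. norm (X m - X n) < e"
      using CauchyD[OF \<open>Cauchy X\<close>] by metis
    have "norm (coord (X m) i - coord (X n) i) \<le> norm (X m - X n)" for m n
      using norm_coord_le[of "X m - X n" i] by (simp add: minus_ell2.rep_eq)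
    with M show "\<exists>M. \<forall>m\<ge>M. \<forall>n\<ge>M. norm (coord (X m) i - coord (X n) i) < e"
      by (meson le_less_trans)
  qed
  then have lim: "(\<lambda>n. coord (X n) i) \<longlonglongrightarrow> lim (\<lambda>n. coord (X n) i)" for i
    by (simp add: Cauchy_convergent_iff convergent_LIMSEQ_iff)
  define L where "L i = lim (\<lambda>n. coord (X n) i)" for i
  have bd: "(\<Sum>i\<in>F. (cmod (coord (X m) i - L i))\<^sup>2) \<le> e\<^sup>2"
    if "\<And>m n. m \<ge> M \<Longrightarrow> n \<ge> M \<Longrightarrow> norm (X m - X n) < e" "finite F" "m \<ge> M" for m M F and e :: real
  proof (rule LIMSEQ_le_const2)
    show "(\<lambda>n. \<Sum>i\<in>F. (cmod (coord (X m) i - coord (X n) i))\<^sup>2) \<longlonglongrightarrow> (\<Sum>i\<in>F. (cmod (coord (X m) i - L i))\<^sup>2)"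
      unfolding L_def by (intro tendsto_intros lim)
    show "\<exists>N. \<forall>n\<ge>N. (\<Sum>i\<in>F. (cmod (coord (X m) i - coord (X n) i))\<^sup>2) \<le> e\<^sup>2"
    proof (intro exI allI impI)
      fix n assume "n \<ge> M"
      have "(\<Sum>i\<in>F. (cmod (coord (X m) i - coord (X n) i))\<^sup>2) \<le> (norm (X m - X n))\<^sup>2"
        using sum_coord_le[OF \<open>finite F\<close>, of "X m - X n"] by (simp add: minus_ell2.rep_eq)
      also have "\<dots> \<le> e\<^sup>2" using that(1)[OF \<open>m \<ge> M\<close> \<open>n \<ge> M\<close>] by (intro power_mono) auto
      finally show "(\<Sum>i\<in>F. (cmod (coord (X m) i - coord (X n) i))\<^sup>2) \<le> e\<^sup>2" .
    qed
  qed
  obtain M1 where M1: "\<And>m n. m \<ge> M1 \<Longrightarrow> n \<ge> M1 \<Longrightarrow> norm (X m - X n) < 1"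
    using CauchyD[OF \<open>Cauchy X\<close>, of 1] by (metis zero_less_one)
  have "(\<lambda>i. (cmod (coord (X M1) i - L i))\<^sup>2) summable_on UNIV"
    using bd[OF M1] by (intro nonneg_summable_onI[where c = 1]) auto
  \<comment> \<open>\<open>L\<close> is written as \<open>X M1\<close> minus the square-summable
    difference \<open>X M1 - L\<close>.\<close>
  from square_summable_add[OF coord_summable[of "X M1"] square_summable_mult[OF this, of "-1"]]
  have L: "(\<lambda>i. (cmod (L i))\<^sup>2) summable_on UNIV" by simp
  have coordL: "coord (Abs_ell2 L) = L" using L by (simp add: Abs_ell2_inverse)
  have "X \<longlonglongrightarrow> Abs_ell2 L"
  proof (rule LIMSEQ_I)
    fix r :: real assume "r > 0"
    then obtain M where M: "\<And>m n. m \<ge> M \<Longrightarrow> n \<ge> M \<Longrightarrow> norm (X m - X n) < r/2"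
      using CauchyD[OF \<open>Cauchy X\<close>, of "r/2"] by (metis half_gt_zero)
    have "norm (X m - Abs_ell2 L) \<le> r/2" if "m \<ge> M" for m
      using bd[OF M _ that] \<open>r > 0\<close> by (intro norm_ell2_le) (auto simp: minus_ell2.rep_eq coordL)
    then show "\<exists>M. \<forall>m\<ge>M. norm (X m - Abs_ell2 L) < r"
      using \<open>r > 0\<close> by (intro exI[of _ M]) (smt (verit) field_sum_of_halves)
  qed
  then show "convergent X" by (auto simp: convergent_def)
qed

instance ell2 :: (type) banach ..

section \<open>Dictionary between the type \<open>ell2\<close> and square-summable vectors\<close>

lemma norm_l2sq:
  fixes x :: "(('n \<Rightarrow> nat) \<times> ('n \<Rightarrow> nat) \<times> 'x) ell2"
  shows "l2sq (coord x) = ennreal ((norm x)\<^sup>2)"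
proof -
  have "Infinite_Set_Sum.abs_summable_on (\<lambda>i. (cmod (coord x i))\<^sup>2) UNIV"
    using coord_summable[of x] by (simp add: abs_summable_equivalent[symmetric])
  then show ?thesis
    unfolding l2sq_def norm_ell2_sq by (simp add: nn_integral_conv_infsetsum infsetsum_infsum)
qed

lemma in_l2_iff: "in_l2 \<psi> \<longleftrightarrow> (\<lambda>i. (cmod (\<psi> i))\<^sup>2) summable_on UNIV"
proof
  assume "in_l2 \<psi>"
  then have "Infinite_Set_Sum.abs_summable_on (\<lambda>i. (cmod (\<psi> i))\<^sup>2) UNIV"
    by (simp add: in_l2_def l2sq_def abs_summable_on_def integrable_iff_bounded)
  then show "(\<lambda>i. (cmod (\<psi> i))\<^sup>2) summable_on UNIV"
    by (simp add: abs_summable_equivalent[symmetric])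
next
  assume "(\<lambda>i. (cmod (\<psi> i))\<^sup>2) summable_on UNIV"
  then show "in_l2 \<psi>"
    using norm_l2sq[of "Abs_ell2 \<psi>"] by (simp add: Abs_ell2_inverse in_l2_def)
qed

lemma coord_Abs: "in_l2 \<psi> \<Longrightarrow> coord (Abs_ell2 \<psi>) = \<psi>"
  by (simp add: in_l2_iff Abs_ell2_inverse)

lemma in_l2_coord: "in_l2 (coord x)"
  by (simp add: in_l2_iff coord_summable)

lemma l2norm_coord: "l2norm (coord x) = norm x"
  by (simp add: l2norm_def norm_l2sq)

lemma in_l2_add: "in_l2 v \<Longrightarrow> in_l2 w \<Longrightarrow> in_l2 (\<lambda>j. v j + w j)"
  by (simp add: in_l2_iff square_summable_add)

lemma in_l2_scale: "in_l2 v \<Longrightarrow> in_l2 (\<lambda>j. c * v j)"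
  by (simp add: in_l2_iff square_summable_mult)

lemma Abs_add: "in_l2 v \<Longrightarrow> in_l2 w \<Longrightarrow> Abs_ell2 (\<lambda>j. v j + w j) = Abs_ell2 v + Abs_ell2 w"
  by (rule coord_inject[THEN iffD1]) (simp add: coord_Abs in_l2_add plus_ell2.rep_eq)

lift_definition cscale :: "complex \<Rightarrow> 'i ell2 \<Rightarrow> 'i ell2" is "\<lambda>c f i. c * f i"
  by (rule square_summable_mult)

lemma Abs_scale: "in_l2 v \<Longrightarrow> Abs_ell2 (\<lambda>j. c * v j) = cscale c (Abs_ell2 v)"
  by (rule coord_inject[THEN iffD1]) (simp add: coord_Abs in_l2_scale cscale.rep_eq)

lemma norm_cscale: "norm (cscale c x) = cmod c * norm x"
proof -
  have "(norm (cscale c x))\<^sup>2 = (cmod c * norm x)\<^sup>2"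
    by (simp add: norm_ell2_sq cscale.rep_eq norm_mult power_mult_distrib infsum_cmult_right')
  then show ?thesis by (simp add: power2_eq_iff_nonneg)
qed

lemma cscale_real: "cscale (of_real r) x = r *\<^sub>R x"
  by transfer simp

lemma bounded_linear_cscale: "bounded_linear (cscale c)"
proof (rule bounded_linear_intro[where K = "cmod c"])
  show "cscale c (x + y) = cscale c x + cscale c y" for x y :: "'a ell2"
    by transfer (simp add: algebra_simps)
  show "cscale c (r *\<^sub>R x) = r *\<^sub>R cscale c x" for r and x :: "'a ell2"
    by transfer (simp add: algebra_simps)
qed (simp add: norm_cscale mult.commute)

subsection \<open>One-parameter groups of entire skew-symmetric operators\<close>

text \<open>\<open>D\<close> stands for the finitely supported vectors and \<open>B\<close> for -i
  q_\<delta>. Skewness is self-adjointness of q_\<delta> seen by the real inner product;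
  \<open>entire\<close> takes the place of spectral theory, since the exponential can then be
  defined by its series.\<close>

locale entire_skew =
  fixes D :: "'h::{real_inner, banach} set" and B :: "'h \<Rightarrow> 'h"
  assumes subspace_D: "subspace D"
    and dense_D: "closure D = UNIV"
    and B_in: "v \<in> D \<Longrightarrow> B v \<in> D"
    and B_add: "v \<in> D \<Longrightarrow> w \<in> D \<Longrightarrow> B (v + w) = B v + B w"
    and B_scale: "v \<in> D \<Longrightarrow> B (c *\<^sub>R v) = c *\<^sub>R B v"
    and skew: "v \<in> D \<Longrightarrow> w \<in> D \<Longrightarrow> B v \<bullet> w = - (v \<bullet> B w)"
    and entire: "v \<in> D \<Longrightarrow> 0 \<le> t \<Longrightarrow> summable (\<lambda>n. t ^ n / fact n * norm ((B ^^ n) v))"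
begin

text \<open>The degrees lie below n, so differentiation lowers n by one. Unlike the full series,
  these sums stay in \<open>D\<close>.\<close>

definition texp :: "nat \<Rightarrow> real \<Rightarrow> 'h \<Rightarrow> 'h" where
  "texp n t v = (\<Sum>k<n. (t ^ k / fact k) *\<^sub>R (B ^^ k) v)"

definition V :: "real \<Rightarrow> 'h \<Rightarrow> 'h" where
  "V t v = (\<Sum>k. (t ^ k / fact k) *\<^sub>R (B ^^ k) v)"

text \<open>Remainder of the series of norms at time t; at time T it controls the Taylor remainder
  uniformly for times of modulus at most T.\<close>

definition tail :: "nat \<Rightarrow> real \<Rightarrow> 'h \<Rightarrow> real" where
  "tail n t v = (\<Sum>k. t ^ (k + n) / fact (k + n) * norm ((B ^^ (k + n)) v))"

lemma iter_in: "v \<in> D \<Longrightarrow> (B ^^ n) v \<in> D"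
  by (induction n) (auto simp: B_in)

lemma iter_add: "v \<in> D \<Longrightarrow> w \<in> D \<Longrightarrow> (B ^^ n) (v + w) = (B ^^ n) v + (B ^^ n) w"
  by (induction n) (auto simp: B_add iter_in)

lemma iter_scale: "v \<in> D \<Longrightarrow> (B ^^ n) (c *\<^sub>R v) = c *\<^sub>R (B ^^ n) v"
  by (induction n) (auto simp: B_scale iter_in)

lemma iter_shift: "(B ^^ n) (B v) = B ((B ^^ n) v)"
  by (simp add: funpow_swap1)

lemma summable_exp: "v \<in> D \<Longrightarrow> summable (\<lambda>k. (t ^ k / fact k) *\<^sub>R (B ^^ k) v)"
  by (rule summable_norm_cancel) (use entire[of v "\<bar>t\<bar>"] in \<open>simp add: power_abs\<close>)

lemma V_sums: "v \<in> D \<Longrightarrow> (\<lambda>k. (t ^ k / fact k) *\<^sub>R (B ^^ k) v) sums V t v"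
  unfolding V_def by (intro summable_sums summable_exp)

lemma texp_lim: "v \<in> D \<Longrightarrow> (\<lambda>n. texp n t v) \<longlonglongrightarrow> V t v"
  using V_sums unfolding texp_def sums_def .

lemma V_0 [simp]: "V 0 v = v"
proof -
  have "V 0 v = (\<Sum>k. if k = 0 then v else 0)"
    unfolding V_def by (intro suminf_cong) auto
  then show ?thesis using sums_If_finite[of "\<lambda>k. k = 0" "\<lambda>_. v"] by (simp add: sums_iff)
qed

lemma V_texp_le:
  assumes "v \<in> D" "\<bar>t\<bar> \<le> T"
  shows "norm (V t v - texp n t v) \<le> tail n T v"
proof -
  have eq: "V t v - texp n t v = (\<Sum>k. (t ^ (k + n) / fact (k + n)) *\<^sub>R (B ^^ (k + n)) v)"
    unfolding V_def texp_def by (subst suminf_split_initial_segment[OF summable_exp[OF assms(1)], of t n]) simp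
  have sm: "summable (\<lambda>k. T ^ (k + n) / fact (k + n) * norm ((B ^^ (k + n)) v))"
    using entire[OF assms(1), of T] assms(2) by (subst summable_iff_shift) linarith
  show ?thesis
    unfolding eq tail_def
  proof (rule norm_suminf_le[OF _ sm])
    fix k
    have "\<bar>t\<bar> ^ (k + n) \<le> T ^ (k + n)" using assms(2) by (intro power_mono) auto
    then show "norm ((t ^ (k + n) / fact (k + n)) *\<^sub>R (B ^^ (k + n)) v)
        \<le> T ^ (k + n) / fact (k + n) * norm ((B ^^ (k + n)) v)"
      by (simp add: power_abs divide_right_mono mult_right_mono)
  qed
qed

lemma tail_tendsto:
  assumes "v \<in> D" "0 \<le> T"
  shows "(\<lambda>n. tail n T v) \<longlonglongrightarrow> 0"
proof -
  let ?f = "\<lambda>n. T ^ n / fact n * norm ((B ^^ n) v)"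
  have "tail n T v = suminf ?f - sum ?f {..<n}" for n
    unfolding tail_def by (subst suminf_split_initial_segment[OF entire[OF assms], of n]) simp
  moreover have "(\<lambda>n. suminf ?f - sum ?f {..<n}) \<longlonglongrightarrow> suminf ?f - suminf ?f"
    by (intro tendsto_intros summable_LIMSEQ entire assms)
  ultimately show ?thesis by simp
qed

lemma V_add: "v \<in> D \<Longrightarrow> w \<in> D \<Longrightarrow> V t (v + w) = V t v + V t w"
  unfolding V_def by (subst suminf_add) (auto simp: summable_exp iter_add scaleR_add_right)

lemma V_scale: "v \<in> D \<Longrightarrow> V t (c *\<^sub>R v) = c *\<^sub>R V t v"
  using bounded_linear.suminf[OF bounded_linear_scaleR_right[of c] summable_exp, of v t]
  by (simp add: V_def iter_scale mult.commute)

lemma V_diff: "v \<in> D \<Longrightarrow> w \<in> D \<Longrightarrow> V t (v - w) = V t v - V t w"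
  using V_add[of v "(-1) *\<^sub>R w" t] V_scale[of w t "-1"] subspace_D
  by (simp add: subspace_neg)

lemma texp_Suc_deriv:
  "((\<lambda>t. texp (Suc n) t v) has_vector_derivative texp n t (B v)) (at t within S)"
proof (induction n)
  case 0
  then show ?case by (auto simp: texp_def intro: has_vector_derivative_const)
next
  case (Suc n)
  have "((\<lambda>t::real. (t ^ Suc n / fact (Suc n))) has_field_derivative t ^ n / fact n) (at t within S)"
    using DERIV_cdivide[OF DERIV_pow[of "Suc n" t S], of "fact (Suc n)"] by (simp del: of_nat_Suc)
  then have "((\<lambda>t. (t ^ Suc n / fact (Suc n)) *\<^sub>R (B ^^ Suc n) v) has_vector_derivative
      (t ^ n / fact n) *\<^sub>R (B ^^ Suc n) v) (at t within S)"
    using has_vector_derivative_scaleR[OF _ has_vector_derivative_const, of _ "t ^ n / fact n"]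
    by (simp del: fact_Suc power_Suc funpow.simps)
  from has_vector_derivative_add[OF Suc.IH this] show ?case
    by (simp add: texp_def iter_shift)
qed

text \<open>Termwise differentiation, justified by uniform convergence of the derivatives on a
  bounded interval around t. The derivative is written \<open>V t (B v)\<close> because
  \<open>V t v\<close> need not lie in \<open>D\<close>, where \<open>B\<close> is
  controlled.\<close>

lemma V_deriv:
  assumes "v \<in> D"
  shows "((\<lambda>t. V t v) has_vector_derivative V t (B v)) (at t)"
proof -
  define R where "R = \<bar>t\<bar> + 1"
  have t: "t \<in> {-R<..<R}" and "0 \<le> R" by (auto simp: R_def)
  have "\<exists>g. \<forall>x\<in>{-R<..<R}. (\<lambda>n. texp (Suc n) x v) \<longlonglongrightarrow> g x \<and>
      (g has_derivative (\<lambda>h. h *\<^sub>R V x (B v))) (at x within {-R<..<R})"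
  proof (rule has_derivative_sequence[where f' = "\<lambda>n x h. h *\<^sub>R texp n x (B v)"])
    show "((\<lambda>t. texp (Suc n) t v) has_derivative (\<lambda>h. h *\<^sub>R texp n x (B v))) (at x within {-R<..<R})" for n x
      using texp_Suc_deriv by (simp add: has_vector_derivative_def)
    show "\<forall>\<^sub>F n in sequentially. \<forall>x\<in>{-R<..<R}. \<forall>h. norm (h *\<^sub>R texp n x (B v) - h *\<^sub>R V x (B v)) \<le> e * norm h"
      if "e > 0" for e
    proof -
      have "\<forall>\<^sub>F n in sequentially. tail n R (B v) < e"
        using tail_tendsto[OF B_in[OF assms] \<open>0 \<le> R\<close>] that by (rule order_tendstoD)
      then show ?thesis
      proof eventually_elim
        case (elim n)
        show ?case
        proof (intro ballI allI)
          fix x h :: real assume "x \<in> {-R<..<R}"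
          then have "\<bar>x\<bar> \<le> R" by auto
          then have "norm (texp n x (B v) - V x (B v)) \<le> e"
            using V_texp_le[OF B_in[OF assms], of x R n] elim by (simp add: norm_minus_commute)
          then show "norm (h *\<^sub>R texp n x (B v) - h *\<^sub>R V x (B v)) \<le> e * norm h"
            using mult_left_mono[of _ e "\<bar>h\<bar>"] by (simp add: scaleR_diff_right[symmetric] mult.commute[of e])
        qed
      qed
    qed
    show "(\<lambda>n. texp (Suc n) t v) \<longlonglongrightarrow> V t v"
      by (intro LIMSEQ_Suc texp_lim assms)
  qed (use t in auto)
  then obtain g where g: "\<And>x. x \<in> {-R<..<R} \<Longrightarrow> (\<lambda>n. texp (Suc n) x v) \<longlonglongrightarrow> g x"
    "\<And>x. x \<in> {-R<..<R} \<Longrightarrow> (g has_derivative (\<lambda>h. h *\<^sub>R V x (B v))) (at x within {-R<..<R})"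
    by blast
  have "g x = V x v" if "x \<in> {-R<..<R}" for x
    using LIMSEQ_unique[OF g(1)[OF that] LIMSEQ_Suc[OF texp_lim[OF assms]]] .
  then have "((\<lambda>t. V t v) has_derivative (\<lambda>h. h *\<^sub>R V t (B v))) (at t within {-R<..<R})"
    using has_derivative_transform[OF t _ g(2)[OF t]] by simp
  then show ?thesis
    using t by (simp add: has_vector_derivative_def at_within_open[OF t])
qed

text \<open>Both series leave \<open>D\<close>, so skewness is applied term by term, in one argument
  and then in the other.\<close>

lemma V_skew:
  assumes "v \<in> D" "w \<in> D"
  shows "V x (B v) \<bullet> V y w = - (V x v \<bullet> V y (B w))"
proof -
  have 1: "V x (B v) \<bullet> u = - (V x v \<bullet> B u)" if "u \<in> D" for u
  proof -
    have "(\<lambda>k. ((x ^ k / fact k) *\<^sub>R (B ^^ k) (B v)) \<bullet> u) sums (V x (B v) \<bullet> u)"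
      by (intro bounded_linear.sums[OF bounded_linear_inner_left] V_sums B_in assms)
    moreover have "(\<lambda>k. - (((x ^ k / fact k) *\<^sub>R (B ^^ k) v) \<bullet> B u)) sums (- (V x v \<bullet> B u))"
      by (intro sums_minus bounded_linear.sums[OF bounded_linear_inner_left] V_sums assms)
    moreover have "(\<lambda>k. - (((x ^ k / fact k) *\<^sub>R (B ^^ k) v) \<bullet> B u)) = (\<lambda>k. ((x ^ k / fact k) *\<^sub>R (B ^^ k) (B v)) \<bullet> u)"
      by (simp add: iter_shift skew iter_in assms that)
    ultimately show ?thesis by (simp only: sums_unique2)
  qed
  have "(\<lambda>k. V x (B v) \<bullet> ((y ^ k / fact k) *\<^sub>R (B ^^ k) w)) sums (V x (B v) \<bullet> V y w)"
    by (intro bounded_linear.sums[OF bounded_linear_inner_right] V_sums assms)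
  moreover have "(\<lambda>k. - (V x v \<bullet> ((y ^ k / fact k) *\<^sub>R (B ^^ k) (B w)))) sums (- (V x v \<bullet> V y (B w)))"
    by (intro sums_minus bounded_linear.sums[OF bounded_linear_inner_right] V_sums B_in assms)
  moreover have "(\<lambda>k. - (V x v \<bullet> ((y ^ k / fact k) *\<^sub>R (B ^^ k) (B w)))) = (\<lambda>k. V x (B v) \<bullet> ((y ^ k / fact k) *\<^sub>R (B ^^ k) w))"
    by (simp add: iter_shift 1 iter_in assms)
  ultimately show ?thesis by (simp only: sums_unique2)
qed

text \<open>Shifting both times by t leaves the inner product constant, its derivative being zero by
  \<open>V_skew\<close>; the shifts 0 and -x are compared. Isometry is the case x = y, and the
  adjoint relation behind the group law has the same source.\<close>

lemma V_inner:
  assumes "v \<in> D" "w \<in> D"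
  shows "V x v \<bullet> V y w = v \<bullet> V (y - x) w"
proof -
  define G where "G t = V (x + t) v \<bullet> V (y + t) w" for t
  have shift: "((\<lambda>t. V (z + t) u) has_vector_derivative V (z + t) (B u)) (at t)" if "u \<in> D" for z t u
  proof -
    have "((\<lambda>t. z + t) has_vector_derivative 1) (at t)"
      by (auto intro!: derivative_eq_intros simp flip: has_real_derivative_iff_has_vector_derivative)
    from vector_diff_chain_at[OF this V_deriv[OF that]] show ?thesis by (simp add: o_def)
  qed
  have "(G has_real_derivative 0) (at t)" for t
  proof -
    have "(G has_derivative (\<lambda>h. V (x + t) v \<bullet> (h *\<^sub>R V (y + t) (B w)) + (h *\<^sub>R V (x + t) (B v)) \<bullet> V (y + t) w)) (at t)"
      unfolding G_def using shift[of v x t] shift[of w y t] assms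
      by (intro has_derivative_inner) (auto simp: has_vector_derivative_def)
    moreover have "(\<lambda>h. V (x + t) v \<bullet> (h *\<^sub>R V (y + t) (B w)) + (h *\<^sub>R V (x + t) (B v)) \<bullet> V (y + t) w) = (\<lambda>h. 0 * h)"
      using V_skew[OF assms, of "x + t" "y + t"] by (auto simp: fun_eq_iff)
    ultimately show ?thesis by (simp only: has_field_derivative_def)
  qed
  then have "G 0 = G (- x)" by (metis DERIV_const_ratio_const2 DERIV_isconst_all)
  then show ?thesis by (simp add: G_def)
qed

lemma norm_V: "v \<in> D \<Longrightarrow> norm (V t v) = norm v"
  using V_inner[of v v t t] by (simp add: norm_eq_sqrt_inner)

section \<open>Extension from the dense subspace to the whole space\<close>

lemma V_extends: "\<exists>g. continuous_on UNIV g \<and> (\<forall>v\<in>D. g v = V t v)"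
proof -
  have "uniformly_continuous_on D (V t)"
    unfolding uniformly_continuous_on_def dist_norm
    by (metis V_diff norm_V subspace_D subspace_diff)
  then obtain g where "uniformly_continuous_on (closure D) g" "\<And>v. v \<in> D \<Longrightarrow> V t v = g v"
    using uniformly_continuous_on_extension_on_closure by metis
  then show ?thesis
    by (intro exI[of _ g]) (auto simp: dense_D dest: uniformly_continuous_imp_continuous)
qed

definition U :: "real \<Rightarrow> 'h \<Rightarrow> 'h" where
  "U t = (SOME g. continuous_on UNIV g \<and> (\<forall>v\<in>D. g v = V t v))"

lemma U_cont: "continuous_on UNIV (U t)" and U_eq_V: "v \<in> D \<Longrightarrow> U t v = V t v"
  using someI_ex[OF V_extends[of t]] unfolding U_def by blast+

lemma U_cont' [continuous_intros]: "continuous_on S f \<Longrightarrow> continuous_on S (\<lambda>x. U t (f x))"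
  using continuous_on_compose2[OF U_cont] by blast

lemma dense_eqI:
  fixes f g :: "'h \<Rightarrow> 'b::real_normed_vector"
  assumes "continuous_on UNIV f" "continuous_on UNIV g" "\<And>v. v \<in> D \<Longrightarrow> f v = g v"
  shows "f x = g x"
proof -
  have "closure D \<subseteq> {x. f x = g x}"
    using assms by (intro closure_minimal closed_Collect_eq) auto
  then show ?thesis by (auto simp: dense_D)
qed

lemma U_inner: "U x a \<bullet> U y b = a \<bullet> U (y - x) b"
proof -
  have *: "U x v \<bullet> U y b = v \<bullet> U (y - x) b" if "v \<in> D" for v
    by (rule dense_eqI[of "\<lambda>b. U x v \<bullet> U y b" _ b])
      (auto intro!: continuous_intros simp: U_eq_V V_inner that)
  show ?thesis
    by (rule dense_eqI[of "\<lambda>a. U x a \<bullet> U y b" _ a]) (auto intro!: continuous_intros simp: *)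
qed

lemma norm_U: "norm (U t x) = norm x"
  by (rule dense_eqI) (auto intro!: continuous_intros simp: U_eq_V norm_V)

lemma U_0 [simp]: "U 0 x = x"
  by (rule dense_eqI) (auto intro!: continuous_intros simp: U_eq_V)

lemma inner_U: "a \<bullet> U t b = U (- t) a \<bullet> b"
  using U_inner[of "- t" a 0 b] by simp

lemma inner_ext: "(\<And>a. a \<bullet> x = a \<bullet> y) \<Longrightarrow> x = (y :: 'h)"
  by (metis inner_eq_zero_iff inner_diff_right right_minus_eq)

text \<open>The series for time s cannot be applied to \<open>U t x\<close>, which may lie outside
  \<open>D\<close>. Testing against arbitrary vectors avoids this, as the adjoint of
  \<open>U s\<close> is \<open>U (- s)\<close>.\<close>

lemma U_add: "U (s + t) x = U s (U t x)"
  by (rule inner_ext) (simp add: inner_U[of _ s] U_inner[of "- s"] add.commute)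

text \<open>An everywhere defined map that has an adjoint is linear.\<close>

lemma linear_U: "linear (U t)"
  by (rule linearI) (rule inner_ext, simp add: inner_U inner_add_right)+

text \<open>Meant for J = multiplication by a complex number: the locale sees only real scalars, and
  this recovers complex linearity.\<close>

lemma U_commute:
  assumes "bounded_linear J" "\<And>v. v \<in> D \<Longrightarrow> J v \<in> D" "\<And>v. v \<in> D \<Longrightarrow> B (J v) = J (B v)"
  shows "U t (J x) = J (U t x)"
proof (rule dense_eqI[of "\<lambda>x. U t (J x)"])
  fix v assume v: "v \<in> D"
  have iter: "(B ^^ n) (J v) = J ((B ^^ n) v)" for n
    by (induction n) (simp_all add: assms iter_in v)
  have "(\<lambda>k. J ((t ^ k / fact k) *\<^sub>R (B ^^ k) v)) sums J (V t v)"
    by (intro bounded_linear.sums[OF assms(1)] V_sums v)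
  moreover have "(\<lambda>k. J ((t ^ k / fact k) *\<^sub>R (B ^^ k) v)) sums V t (J v)"
    using V_sums[OF assms(2)[OF v], of t] by (simp add: iter linear_scale[OF bounded_linear.linear[OF assms(1)]])
  ultimately show "U t (J v) = J (U t v)"
    by (simp add: sums_unique2 U_eq_V assms v)
next
  have J: "continuous_on UNIV J" by (intro linear_continuous_on assms)
  show "continuous_on UNIV (\<lambda>x. U t (J x))" by (intro U_cont' J)
  show "continuous_on UNIV (\<lambda>x. J (U t x))" using continuous_on_compose2[OF J U_cont] by simp
qed

text \<open>Orbits of vectors in \<open>D\<close> are differentiable, hence continuous; isometry
  carries this over to their limits with an error of e/3 on each side.\<close>

lemma U_strong: "((\<lambda>t. U t x) \<longlongrightarrow> U t0 x) (at t0)"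
proof (rule tendstoI)
  fix e :: real assume "e > 0"
  obtain v where v: "v \<in> D" "dist v x < e/3"
    using closure_approachable[of x D] dense_D \<open>e > 0\<close> by (metis UNIV_I divide_pos_pos zero_less_numeral)
  have "((\<lambda>t. V t v) \<longlongrightarrow> V t0 v) (at t0)"
    using has_vector_derivative_continuous[OF V_deriv[OF v(1)]] by (simp add: continuous_at)
  then have "\<forall>\<^sub>F t in at t0. dist (V t v) (V t0 v) < e/3"
    using \<open>e > 0\<close> by (intro tendstoD) auto
  then show "\<forall>\<^sub>F t in at t0. dist (U t x) (U t0 x) < e"
  proof eventually_elim
    case (elim t)
    have d: "dist (U s a) (U s b) = dist a b" for s a b
      by (metis dist_norm linear_diff linear_U norm_U)
    have "dist (U t x) (U t0 x) \<le> dist (U t x) (U t v) + dist (U t v) (U t0 v) + dist (U t0 v) (U t0 x)"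
      by metric
    also have "\<dots> < e" using elim v d[of t x v] d[of t0 v x] by (simp add: U_eq_V dist_commute)
    finally show ?case .
  qed
qed

section \<open>Comparison of an abstract isometric group with the series\<close>

lemma texp_le:
  assumes "v \<in> D" "\<bar>t\<bar> \<le> T"
  shows "norm (texp n t v) \<le> norm v + tail n T v"
  using V_texp_le[OF assms, of n] norm_V[OF assms(1), of t] norm_triangle_ineq3[of "texp n t v" "V t v"]
  by (simp add: norm_minus_commute[of "texp n t v"])

text \<open>The group law writes \<open>u t w\<close> as \<open>u t0 (u (t - t0) w)\<close>, which
  transports the derivative at 0 to every time.\<close>

lemma group_deriv:
  fixes u :: "real \<Rightarrow> 'h \<Rightarrow> 'h"
  assumes lin: "\<And>t. linear (u t)" and iso: "\<And>t x. norm (u t x) = norm x"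
    and add: "\<And>s t x. u (s + t) x = u s (u t x)"
    and deriv: "((\<lambda>t. u t w) has_vector_derivative c) (at 0)"
  shows "((\<lambda>t. u t w) has_vector_derivative u t0 c) (at t0)"
proof -
  have "((\<lambda>t. t - t0) has_vector_derivative 1) (at t0)"
    by (auto intro!: derivative_eq_intros simp flip: has_real_derivative_iff_has_vector_derivative)
  from vector_diff_chain_at[OF this, of "\<lambda>t. u t w" c] deriv
  have "((\<lambda>t. u (t - t0) w) has_vector_derivative c) (at t0)" by (simp add: o_def)
  moreover have "bounded_linear (u t0)"
    using lin[of t0] iso[of t0] by (intro bounded_linear_intro[of _ 1]) (auto simp: linear_add linear_scale)
  ultimately have "((\<lambda>t. u t0 (u (t - t0) w)) has_vector_derivative u t0 c) (at t0)"
    by (rule bounded_linear.has_vector_derivative[rotated])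
  then show ?thesis by (simp flip: add)
qed

text \<open>Since \<open>\<psi>\<close> evolves through Taylor polynomials only, \<open>r \<mapsto> u (- r) (texp m r \<psi>)\<close> is differentiable
without any knowledge of the domain of the generator of \<open>u\<close>.\<close>

lemma duhamel_deriv:
  fixes u :: "real \<Rightarrow> 'h \<Rightarrow> 'h" and r :: real
  assumes lin: "\<And>t. linear (u t)" and iso: "\<And>t x. norm (u t x) = norm x"
    and add: "\<And>s t x. u (s + t) x = u s (u t x)"
    and deriv: "\<And>j. ((\<lambda>t. u t ((B ^^ j) \<psi>)) has_vector_derivative C j) (at 0)"
    and C: "\<And>j. C j = (B ^^ Suc j) \<psi> + \<delta> *\<^sub>R ((B ^^ j) a - real j *\<^sub>R (B ^^ (j - 1)) b)"
  shows "((\<lambda>r. u (- r) (texp (Suc m) r \<psi>)) has_vector_derivative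
      u (- r) (- ((r ^ m / fact m) *\<^sub>R (B ^^ m) (B \<psi>)) - \<delta> *\<^sub>R (texp (Suc m) r a - r *\<^sub>R texp m r b))) (at r)"
proof -
  have u_minus: "((\<lambda>r. u (- r) ((B ^^ k) \<psi>)) has_vector_derivative - u (- r) (C k)) (at r)" for k r
  proof -
    have "(uminus has_vector_derivative (-1)) (at r)"
      by (auto intro!: derivative_eq_intros simp flip: has_real_derivative_iff_has_vector_derivative)
    from vector_diff_chain_at[OF this group_deriv[OF lin iso add deriv, where ?t0.0 = "- r"]] show ?thesis
      by (simp add: o_def)
  qed
  have pow: "((\<lambda>r. r ^ k / fact k) has_field_derivative real k * r ^ (k - 1) / fact k) (at r)" for k and r :: real
    using DERIV_cdivide[OF DERIV_pow[of k r UNIV], of "fact k"] by simp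
  have "((\<lambda>r. (r ^ k / fact k) *\<^sub>R u (- r) ((B ^^ k) \<psi>)) has_vector_derivative
      (r ^ k / fact k) *\<^sub>R (- u (- r) (C k)) + (real k * r ^ (k - 1) / fact k) *\<^sub>R u (- r) ((B ^^ k) \<psi>)) (at r)" for k
    by (rule has_vector_derivative_scaleR[OF pow u_minus])
  then have "((\<lambda>r. \<Sum>k<Suc m. (r ^ k / fact k) *\<^sub>R u (- r) ((B ^^ k) \<psi>)) has_vector_derivative
      (\<Sum>k<Suc m. (r ^ k / fact k) *\<^sub>R (- u (- r) (C k)) + (real k * r ^ (k - 1) / fact k) *\<^sub>R u (- r) ((B ^^ k) \<psi>))) (at r)"
    by (intro has_vector_derivative_sum)
  also have "(\<Sum>k<Suc m. (r ^ k / fact k) *\<^sub>R (- u (- r) (C k)) + (real k * r ^ (k - 1) / fact k) *\<^sub>R u (- r) ((B ^^ k) \<psi>))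
      = u (- r) (\<Sum>k<Suc m. (real k * r ^ (k - 1) / fact k) *\<^sub>R (B ^^ k) \<psi> - (r ^ k / fact k) *\<^sub>R C k)"
    by (simp add: linear_sum[OF lin] linear_diff[OF lin] linear_scale[OF lin] linear_add[OF lin])
  \<comment> \<open>The sum telescopes: the derivative of the k-th coefficient cancels the leading
    part of \<open>C (k - 1)\<close>, so only the top term of degree m remains beside the
    \<delta>-part. In the latter, the factor k in front of b lowers the factorial and leaves r times
    a shorter Taylor sum.\<close>
  also have "(\<Sum>k<Suc m. (real k * r ^ (k - 1) / fact k) *\<^sub>R (B ^^ k) \<psi> - (r ^ k / fact k) *\<^sub>R C k)
      = - ((r ^ m / fact m) *\<^sub>R (B ^^ m) (B \<psi>)) - \<delta> *\<^sub>R (texp (Suc m) r a - r *\<^sub>R texp m r b)"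
  proof (induction m)
    case 0
    show ?case by (simp add: C texp_def)
  next
    case (Suc m)
    have c: "real (Suc m) * r ^ m / fact (Suc m) = r ^ m / fact m"
      by (simp del: of_nat_Suc)
    have c': "r ^ Suc m / fact (Suc m) * real (Suc m) = r * (r ^ m / fact m)"
      by (simp del: of_nat_Suc)
    have "(\<Sum>k<Suc (Suc m). (real k * r ^ (k - 1) / fact k) *\<^sub>R (B ^^ k) \<psi> - (r ^ k / fact k) *\<^sub>R C k)
      = - ((r ^ m / fact m) *\<^sub>R (B ^^ m) (B \<psi>)) - \<delta> *\<^sub>R (texp (Suc m) r a - r *\<^sub>R texp m r b)
        + ((real (Suc m) * r ^ m / fact (Suc m)) *\<^sub>R (B ^^ Suc m) \<psi> - (r ^ Suc m / fact (Suc m)) *\<^sub>R C (Suc m))"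
      by (subst sum.lessThan_Suc, subst Suc.IH) simp
    also have "(r ^ Suc m / fact (Suc m)) *\<^sub>R C (Suc m) = (r ^ Suc m / fact (Suc m)) *\<^sub>R (B ^^ Suc m) (B \<psi>)
        + \<delta> *\<^sub>R ((r ^ Suc m / fact (Suc m)) *\<^sub>R (B ^^ Suc m) a - (r * (r ^ m / fact m)) *\<^sub>R (B ^^ m) b)"
      unfolding C c'[symmetric]
      by (simp add: iter_shift scaleR_add_right scaleR_diff_right mult.commute mult.left_commute
          del: fact_Suc of_nat_Suc power_Suc)
    finally show ?case
      by (simp add: c texp_def iter_shift algebra_simps del: fact_Suc of_nat_Suc power_Suc)
  qed
  finally show ?thesis
    by (simp add: texp_def linear_sum[OF lin] linear_scale[OF lin] linear_add[OF lin])
qed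

text \<open>Mean value inequality on [0, |s|] for \<open>F m\<close>. Its derivative is bounded by
  \<delta> (|a| + r |b|) up to an error that vanishes as m grows, and the primitive of this bound is
  the right-hand side.\<close>

lemma duhamel_nonzero:
  fixes u :: "real \<Rightarrow> 'h \<Rightarrow> 'h"
  assumes lin: "\<And>t. linear (u t)" and iso: "\<And>t x. norm (u t x) = norm x"
    and add: "\<And>s t x. u (s + t) x = u s (u t x)" and u0: "\<And>x. u 0 x = x"
    and deriv: "\<And>j. ((\<lambda>t. u t ((B ^^ j) \<psi>)) has_vector_derivative C j) (at 0)"
    and C: "\<And>j. C j = (B ^^ Suc j) \<psi> + \<delta> *\<^sub>R ((B ^^ j) a - real j *\<^sub>R (B ^^ (j - 1)) b)"
    and D: "\<psi> \<in> D" "a \<in> D" "b \<in> D" and "0 \<le> \<delta>" "s \<noteq> 0"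
  shows "norm (u s \<psi> - V s \<psi>) \<le> \<delta> * (\<bar>s\<bar> * norm a + s\<^sup>2 / 2 * norm b)"
proof -
  \<comment> \<open>Negative times are run forward through the sign of s; s \<noteq> 0 makes the
    interval from 0 to \<open>S\<close> nondegenerate.\<close>
  define \<sigma> where "\<sigma> = sgn s"
  define S where "S = \<bar>s\<bar>"
  have S: "0 < S" "\<sigma> * S = s" "\<bar>\<sigma>\<bar> = 1" using \<open>s \<noteq> 0\<close> by (auto simp: S_def \<sigma>_def sgn_mult_abs abs_sgn_eq)
  define F where "F m r = u (- (\<sigma> * r)) (texp (Suc m) (\<sigma> * r) \<psi>)" for m r
  define F' where "F' m r = \<sigma> *\<^sub>R u (- (\<sigma> * r)) (- (((\<sigma> * r) ^ m / fact m) *\<^sub>R (B ^^ m) (B \<psi>))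
      - \<delta> *\<^sub>R (texp (Suc m) (\<sigma> * r) a - (\<sigma> * r) *\<^sub>R texp m (\<sigma> * r) b))" for m r
  \<comment> \<open>All truncation errors: the Taylor term of \<psi> left by the telescoping, and
    the remainders of the sums for a and b.\<close>
  define \<eta> where "\<eta> m = S ^ m / fact m * norm ((B ^^ m) (B \<psi>)) + \<delta> * (tail (Suc m) S a + S * tail m S b)" for m
  have F: "(F m has_vector_derivative F' m r) (at r)" for m r
  proof -
    have "((*) \<sigma> has_vector_derivative \<sigma>) (at r)"
      by (auto intro!: derivative_eq_intros simp flip: has_real_derivative_iff_has_vector_derivative)
    from vector_diff_chain_at[OF this duhamel_deriv[OF lin iso add deriv C, of m]] show ?thesis
      by (simp add: o_def F_def[abs_def] F'_def)
  qed
  have F'_le: "norm (F' m r) \<le> \<delta> * (norm a + r * norm b) + \<eta> m" if "0 < r" "r < S" for m r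
  proof -
    have r: "\<bar>\<sigma> * r\<bar> \<le> S" "\<bar>\<sigma> * r\<bar> = r" using that S by (auto simp: abs_mult)
    have "norm (F' m r) = norm (- (((\<sigma> * r) ^ m / fact m) *\<^sub>R (B ^^ m) (B \<psi>))
      - \<delta> *\<^sub>R (texp (Suc m) (\<sigma> * r) a - (\<sigma> * r) *\<^sub>R texp m (\<sigma> * r) b))"
      by (simp add: F'_def iso S)
    also have "\<dots> \<le> norm (((\<sigma> * r) ^ m / fact m) *\<^sub>R (B ^^ m) (B \<psi>))
        + norm (\<delta> *\<^sub>R (texp (Suc m) (\<sigma> * r) a - (\<sigma> * r) *\<^sub>R texp m (\<sigma> * r) b))"
      by (rule order_trans[OF norm_triangle_ineq4]) simp
    also have "norm (((\<sigma> * r) ^ m / fact m) *\<^sub>R (B ^^ m) (B \<psi>)) = r ^ m / fact m * norm ((B ^^ m) (B \<psi>))"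
      using arg_cong[OF r(2), of "\<lambda>z. z ^ m"] by (simp add: power_abs del: abs_mult)
    also have "\<dots> \<le> S ^ m / fact m * norm ((B ^^ m) (B \<psi>))"
      using that by (intro mult_right_mono divide_right_mono power_mono) auto
    also have "norm (\<delta> *\<^sub>R (texp (Suc m) (\<sigma> * r) a - (\<sigma> * r) *\<^sub>R texp m (\<sigma> * r) b))
        \<le> \<delta> * (norm (texp (Suc m) (\<sigma> * r) a) + r * norm (texp m (\<sigma> * r) b))"
      using \<open>0 \<le> \<delta>\<close> norm_triangle_ineq4[of "texp (Suc m) (\<sigma> * r) a" "(\<sigma> * r) *\<^sub>R texp m (\<sigma> * r) b"] r(2)
      by (simp add: mult_left_mono)
    also have "\<dots> \<le> \<delta> * ((norm a + tail (Suc m) S a) + (r * norm b + S * tail m S b))"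
    proof -
      have texp_b: "norm (texp m (\<sigma> * r) b) \<le> norm b + tail m S b" by (rule texp_le[OF D(3) r(1)])
      have "0 \<le> tail m S b" using V_texp_le[OF D(3) r(1), of m] norm_ge_zero order_trans by blast
      then have "r * norm (texp m (\<sigma> * r) b) \<le> r * norm b + S * tail m S b"
        using mult_left_mono[OF texp_b, of r] mult_right_mono[of r S "tail m S b"] that by (simp add: algebra_simps)
      then show ?thesis
        using texp_le[OF D(2) r(1), of "Suc m"] \<open>0 \<le> \<delta>\<close> by (intro mult_left_mono add_mono)
    qed
    finally show ?thesis by (simp add: \<eta>_def algebra_simps)
  qed
  have le: "norm (texp (Suc m) s \<psi> - u s \<psi>) \<le> \<delta> * (S * norm a + S\<^sup>2 / 2 * norm b) + S * \<eta> m" for m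
  proof -
    let ?\<phi> = "\<lambda>r. \<delta> * (r * norm a + r\<^sup>2 / 2 * norm b) + r * \<eta> m"
    have "norm (F m S - F m 0) \<le> ?\<phi> S - ?\<phi> 0"
    proof (rule differentiable_bound_general[OF S(1)])
      show "continuous_on {0..S} (F m)"
        by (intro continuous_at_imp_continuous_on ballI has_vector_derivative_continuous[OF F])
      show "continuous_on {0..S} ?\<phi>" by (intro continuous_intros) auto
      show "(?\<phi> has_vector_derivative \<delta> * (norm a + r * norm b) + \<eta> m) (at r)" for r
        by (auto intro!: derivative_eq_intros simp flip: has_real_derivative_iff_has_vector_derivative)
    qed (use F F'_le in auto)
    \<comment> \<open>The isometry \<open>u s\<close> turns \<open>F m S - F m 0\<close> into the
      Taylor sum at time s minus \<open>u s \<psi>\<close>.\<close>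
    moreover have "norm (F m S - F m 0) = norm (u s (F m S - F m 0))" by (simp add: iso)
    moreover have "u s (F m S) = texp (Suc m) s \<psi>"
      using add[of s "- s" "texp (Suc m) s \<psi>"] by (simp add: F_def S u0)
    moreover have "texp (Suc m) 0 \<psi> = \<psi>"
      by (simp add: texp_def lessThan_Suc_eq_insert_0 sum.reindex)
    then have "F m 0 = \<psi>" by (simp add: F_def u0)
    ultimately show ?thesis by (simp add: linear_diff[OF lin])
  qed
  have \<eta>: "\<eta> \<longlonglongrightarrow> 0 + \<delta> * (0 + S * 0)"
    unfolding \<eta>_def using S D
    by (intro tendsto_intros tail_tendsto LIMSEQ_Suc[OF tail_tendsto] summable_LIMSEQ_zero entire B_in) auto
  have "norm (V s \<psi> - u s \<psi>) \<le> \<delta> * (S * norm a + S\<^sup>2 / 2 * norm b) + S * (0 + \<delta> * (0 + S * 0))"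
  proof (rule LIMSEQ_le)
    show "(\<lambda>m. norm (texp (Suc m) s \<psi> - u s \<psi>)) \<longlonglongrightarrow> norm (V s \<psi> - u s \<psi>)"
      by (intro tendsto_intros LIMSEQ_Suc texp_lim D)
    show "(\<lambda>m. \<delta> * (S * norm a + S\<^sup>2 / 2 * norm b) + S * \<eta> m) \<longlonglongrightarrow>
        \<delta> * (S * norm a + S\<^sup>2 / 2 * norm b) + S * (0 + \<delta> * (0 + S * 0))"
      by (intro tendsto_intros \<eta>)
    show "\<exists>N. \<forall>n\<ge>N. norm (texp (Suc n) s \<psi> - u s \<psi>) \<le> \<delta> * (S * norm a + S\<^sup>2 / 2 * norm b) + S * \<eta> n"
      using le by blast
  qed
  then show ?thesis by (simp add: norm_minus_commute S_def)
qed

lemma duhamel: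
  fixes u :: "real \<Rightarrow> 'h \<Rightarrow> 'h"
  assumes lin: "\<And>t. linear (u t)" and iso: "\<And>t x. norm (u t x) = norm x"
    and add: "\<And>s t x. u (s + t) x = u s (u t x)" and u0: "\<And>x. u 0 x = x"
    and deriv: "\<And>j. ((\<lambda>t. u t ((B ^^ j) \<psi>)) has_vector_derivative C j) (at 0)"
    and C: "\<And>j. C j = (B ^^ Suc j) \<psi> + \<delta> *\<^sub>R ((B ^^ j) a - real j *\<^sub>R (B ^^ (j - 1)) b)"
    and D: "\<psi> \<in> D" "a \<in> D" "b \<in> D" and "0 \<le> \<delta>"
  shows "norm (u s \<psi> - V s \<psi>) \<le> \<delta> * (\<bar>s\<bar> * norm a + s\<^sup>2 / 2 * norm b)"
  using duhamel_nonzero[OF assms, of s] by (cases "s = 0") (simp_all add: u0)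

end

subsection \<open>Growth of iterates\<close>

text \<open>\<open>majorant C K n m\<close> dominates the norm of the \<open>n\<close>-th iterate of the generator on basis vectors with
at most \<open>m\<close> quanta: the terms linear in the mode operators raise \<open>m\<close> and cost a factor \<open>C * sqrt (m + 1)\<close>,
the hopping terms keep \<open>m\<close> and cost \<open>K * (m + 1)\<close>.\<close>

primrec majorant :: "real \<Rightarrow> real \<Rightarrow> nat \<Rightarrow> nat \<Rightarrow> real" where
  "majorant C K 0 m = 1"
| "majorant C K (Suc n) m = C * sqrt (real m + 1) * majorant C K n (Suc m) + K * (real m + 1) * majorant C K n m"

lemma majorant_nonneg: "0 \<le> C \<Longrightarrow> 0 \<le> K \<Longrightarrow> 0 \<le> majorant C K n m"
  by (induction n arbitrary: m) auto

text \<open>Differentiation shifts n by one, which is where the recursion applies; the generating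
  functions thus obey a linear system coupling m to m + 1.\<close>

lemma majorant_sum_deriv:
  "((\<lambda>s. \<Sum>n<Suc N. s ^ n / fact n * majorant C K n m) has_real_derivative
    C * sqrt (real m + 1) * (\<Sum>n<N. s ^ n / fact n * majorant C K n (Suc m))
    + K * (real m + 1) * (\<Sum>n<N. s ^ n / fact n * majorant C K n m)) (at s)"
proof (induction N)
  case 0
  then show ?case by simp
next
  case (Suc N)
  have "((\<lambda>s::real. s ^ Suc N / fact (Suc N)) has_field_derivative s ^ N / fact N) (at s)"
    using DERIV_cdivide[OF DERIV_pow[of "Suc N" s UNIV], of "fact (Suc N)"] by (simp del: of_nat_Suc)
  from DERIV_add[OF Suc.IH DERIV_cmult_right[OF this, of "majorant C K (Suc N) m"]]
  show ?case
    unfolding sum.lessThan_Suc[of _ "Suc N"] by (rule DERIV_cong) (simp add: algebra_simps add_divide_distrib)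
qed

text \<open>The right-hand side is a supersolution on \<open>[0, T]\<close> of the differential inequality obeyed by the partial
sums of the exponential generating function; the square root is absorbed by completing the square.\<close>

lemma sum_majorant_le:
  assumes "0 \<le> C" "0 \<le> K" "0 \<le> t" "t \<le> T"
  defines "E \<equiv> exp ((K + 1) * T)"
  defines "c \<equiv> 1 + K + C\<^sup>2 * E\<^sup>2 / 4"
  shows "(\<Sum>n<N. t ^ n / fact n * majorant C K n m) \<le> exp (c * t + real m * (K + 1) * t)"
  using assms(3,4)
proof (induction N arbitrary: m t)
  case 0
  then show ?case by simp
next
  case (Suc N)
  let ?S = "\<lambda>t m. exp (c * t + real m * (K + 1) * t)"
  let ?R = "\<lambda>N t m. \<Sum>n<N. t ^ n / fact n * majorant C K n m"
  let ?R' = "\<lambda>s. C * sqrt (real m + 1) * ?R N s (Suc m) + K * (real m + 1) * ?R N s m"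
  have le: "?R' s \<le> (c + real m * (K + 1)) * ?S s m" if "0 \<le> s" "s \<le> T" for s
  proof -
    have "?S s (Suc m) = ?S s m * exp ((K + 1) * s)"
      by (simp add: algebra_simps flip: exp_add)
    \<comment> \<open>\<open>E\<close> is the largest price, over the times up to T, of raising m by
      one.\<close>
    also have "\<dots> \<le> ?S s m * E"
      unfolding E_def using that \<open>0 \<le> K\<close> by (intro mult_left_mono) auto
    finally have "?R' s \<le> C * sqrt (real m + 1) * (?S s m * E) + K * (real m + 1) * ?S s m"
      using Suc.IH[OF that, of "Suc m"] Suc.IH[OF that, of m] \<open>0 \<le> C\<close> \<open>0 \<le> K\<close>
      by (intro add_mono mult_left_mono) auto
    also have "\<dots> = (C * E * sqrt (real m + 1) + K * (real m + 1)) * ?S s m"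
      by (simp add: algebra_simps)
    also have "\<dots> \<le> (c + real m * (K + 1)) * ?S s m"
    proof (intro mult_right_mono)
      \<comment> \<open>Here the constants originate: C E sqrt (m + 1) \<le> (m + 1) + C^2 E^2 / 4.
        The summand m + 1 is what turns K into K + 1 in the exponent, and the rest goes into
        c.\<close>
      have "0 \<le> (sqrt (real m + 1) - C * E / 2)\<^sup>2" by simp
      also have "\<dots> = real m + 1 - C * E * sqrt (real m + 1) + C\<^sup>2 * E\<^sup>2 / 4"
        by (simp add: power2_diff power_divide power_mult_distrib)
      finally show "C * E * sqrt (real m + 1) + K * (real m + 1) \<le> c + real m * (K + 1)"
        by (simp add: c_def algebra_simps)
    qed simp
    finally show ?thesis .
  qed
  \<comment> \<open>The difference is nondecreasing in time and vanishes at time 0, where both sides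
    equal 1.\<close>
  have "?S 0 m - ?R (Suc N) 0 m \<le> ?S t m - ?R (Suc N) t m"
  proof (rule DERIV_nonneg_imp_nondecreasing[OF \<open>0 \<le> t\<close>])
    fix s assume s: "0 \<le> s" "s \<le> t"
    have "((\<lambda>s. ?S s m) has_real_derivative (c + real m * (K + 1)) * ?S s m) (at s)"
      by (auto intro!: derivative_eq_intros)
    from DERIV_diff[OF this majorant_sum_deriv]
    have "((\<lambda>s. ?S s m - ?R (Suc N) s m) has_real_derivative (c + real m * (K + 1)) * ?S s m - ?R' s) (at s)" .
    with le[of s] s Suc.prems
    show "\<exists>y. ((\<lambda>s. ?S s m - ?R (Suc N) s m) has_real_derivative y) (at s) \<and> 0 \<le> y"
      by (intro exI[of _ "(c + real m * (K + 1)) * ?S s m - ?R' s"]) auto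
  qed
  moreover have "?R (Suc N) 0 m = 1" by (subst sum.lessThan_Suc_shift) simp
  ultimately show ?case by simp
qed

text \<open>The supersolution depends on the horizon T; taking T = t bounds the partial sums at the
  given time.\<close>

lemma summable_majorant:
  assumes "0 \<le> C" "0 \<le> K" "0 \<le> t"
  shows "summable (\<lambda>n. t ^ n / fact n * majorant C K n m)"
  by (rule summableI_nonneg_bounded)
    (use sum_majorant_le[OF assms order.refl, where m = m] majorant_nonneg assms in auto)

subsection \<open>Operators preserving finite support and their adjoints\<close>

text \<open>The real part of the scalar product; skew-symmetry for it, together with commutation with
complex scalars, is all that unitarity needs.\<close>

definition ip :: "('i \<Rightarrow> complex) \<Rightarrow> ('i \<Rightarrow> complex) \<Rightarrow> real" where
  "ip \<phi> \<psi> = infsum (\<lambda>j. \<phi> j \<bullet> \<psi> j) UNIV"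

lemma finite_vec_in_l2: "finite_vec v \<Longrightarrow> in_l2 v"
  unfolding in_l2_iff finite_vec_def
  by (rule summable_on_cong_neutral[THEN iffD1, OF _ _ _ summable_on_finite]) auto

lemma coord_finite_vec: "finite_vec v \<Longrightarrow> coord (Abs_ell2 v) = v"
  by (simp add: coord_Abs finite_vec_in_l2)

lemma finite_vec_add: "finite_vec v \<Longrightarrow> finite_vec w \<Longrightarrow> finite_vec (\<lambda>j. v j + w j)"
  unfolding finite_vec_def by (rule finite_subset[of _ "{j. v j \<noteq> 0} \<union> {j. w j \<noteq> 0}"]) auto

lemma finite_vec_scale: "finite_vec v \<Longrightarrow> finite_vec (\<lambda>j. c * v j)"
  unfolding finite_vec_def by (rule finite_subset) auto

lemma finite_vec_sum:
  "finite I \<Longrightarrow> (\<And>k. k \<in> I \<Longrightarrow> finite_vec (v k)) \<Longrightarrow> finite_vec (\<lambda>j. \<Sum>k\<in>I. v k j)"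
  by (induction I rule: finite_induct) (auto simp: finite_vec_add, simp add: finite_vec_def)

lemma ip_summable: "finite_vec v \<Longrightarrow> (\<lambda>j. v j \<bullet> w j) summable_on UNIV"
  unfolding finite_vec_def
  by (rule summable_on_cong_neutral[THEN iffD1, OF _ _ _ summable_on_finite]) auto

lemma ip_finite: "finite_vec v \<Longrightarrow> ip v w = (\<Sum>j | v j \<noteq> 0. v j \<bullet> w j)"
  unfolding ip_def finite_vec_def
  by (subst infsum_cong_neutral[where T = "{j. v j \<noteq> 0}"]) auto

lemma ip_add_left: "finite_vec v \<Longrightarrow> finite_vec v' \<Longrightarrow> ip (\<lambda>j. v j + v' j) w = ip v w + ip v' w"
  unfolding ip_def by (simp add: inner_add_left infsum_add ip_summable)

lemma ip_commute: "ip v w = ip w v"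
  by (simp add: ip_def inner_commute)

lemma ip_add_right: "finite_vec w \<Longrightarrow> finite_vec w' \<Longrightarrow> ip v (\<lambda>j. w j + w' j) = ip v w + ip v w'"
  by (simp add: ip_commute[of v] ip_add_left)

lemma ip_scale_left: "ip (\<lambda>j. c * v j) w = ip v (\<lambda>j. cnj c * w j)"
  unfolding ip_def by (simp add: inner_complex_def algebra_simps)

lemma ip_Abs: "finite_vec v \<Longrightarrow> finite_vec w \<Longrightarrow> Abs_ell2 v \<bullet> Abs_ell2 w = ip v w"
  by (simp add: inner_ell2.rep_eq coord_finite_vec ip_def)

lemma norm_Abs_sq: "finite_vec v \<Longrightarrow> (norm (Abs_ell2 v))\<^sup>2 = ip v v"
  by (simp add: power2_norm_eq_inner ip_Abs)

lemma ip_sum_left: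
  "finite I \<Longrightarrow> (\<And>k. k \<in> I \<Longrightarrow> finite_vec (v k)) \<Longrightarrow> ip (\<lambda>j. \<Sum>k\<in>I. v k j) w = (\<Sum>k\<in>I. ip (v k) w)"
proof (induction I rule: finite_induct)
  case empty
  then show ?case by (simp add: ip_def)
qed (simp add: ip_add_left finite_vec_sum)

lemma ip_sum_right:
  "finite I \<Longrightarrow> (\<And>k. k \<in> I \<Longrightarrow> finite_vec (w k)) \<Longrightarrow> ip v (\<lambda>j. \<Sum>k\<in>I. w k j) = (\<Sum>k\<in>I. ip v (w k))"
  by (simp add: ip_commute[of v] ip_sum_left)

text \<open>Linearity is required on all functions: the mode operators are pointwise formulas, so no
  summability conditions arise.\<close>

definition fin_op :: "(('n, 'x) vec \<Rightarrow> ('n, 'x) vec) \<Rightarrow> bool" where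
  "fin_op A \<longleftrightarrow> (\<forall>\<phi> \<psi>. A (\<lambda>j. \<phi> j + \<psi> j) = (\<lambda>j. A \<phi> j + A \<psi> j)) \<and>
     (\<forall>c \<phi>. A (\<lambda>j. c * \<phi> j) = (\<lambda>j. c * A \<phi> j)) \<and> (\<forall>\<phi>. finite_vec \<phi> \<longrightarrow> finite_vec (A \<phi>))"

lemma fin_op_finite: "fin_op A \<Longrightarrow> finite_vec \<phi> \<Longrightarrow> finite_vec (A \<phi>)"
  and fin_op_plus: "fin_op A \<Longrightarrow> A (\<lambda>j. \<phi> j + \<psi> j) = (\<lambda>j. A \<phi> j + A \<psi> j)"
  and fin_op_mult: "fin_op A \<Longrightarrow> A (\<lambda>j. c * \<phi> j) = (\<lambda>j. c * A \<phi> j)"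
  by (simp_all add: fin_op_def)

lemma fin_op_zero: "fin_op A \<Longrightarrow> A (\<lambda>_. 0) = (\<lambda>_. 0)"
  using fin_op_mult[of A 0 "\<lambda>_. 0"] by simp

lemma fin_op_lincomb:
  assumes "fin_op A" "finite I"
  shows "A (\<lambda>j. \<Sum>k\<in>I. c k * \<phi> k j) = (\<lambda>j. \<Sum>k\<in>I. c k * A (\<phi> k) j)"
  using assms(2) by (induction I rule: finite_induct)
    (simp_all add: fin_op_plus[OF assms(1)] fin_op_mult[OF assms(1)] fin_op_zero[OF assms(1)])

lemma fin_op_diff:
  assumes "fin_op A"
  shows "A (\<lambda>j. \<phi> j - \<psi> j) = (\<lambda>j. A \<phi> j - A \<psi> j)"
  using fin_op_plus[OF assms, of \<phi> "\<lambda>j. -1 * \<psi> j"] by (simp only: fin_op_mult[OF assms]) simp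

lemma fin_op_sum_apply:
  assumes "fin_op A" "finite I"
  shows "A (\<lambda>j. \<Sum>k\<in>I. \<phi> k j) = (\<lambda>j. \<Sum>k\<in>I. A (\<phi> k) j)"
  using fin_op_lincomb[OF assms, of "\<lambda>_. 1" \<phi>] by simp

lemma fin_op_add: "fin_op A \<Longrightarrow> fin_op B \<Longrightarrow> fin_op (\<lambda>\<phi> j. A \<phi> j + B \<phi> j)"
  by (auto simp: fin_op_def algebra_simps intro: finite_vec_add)

lemma fin_op_scale: "fin_op A \<Longrightarrow> fin_op (\<lambda>\<phi> j. c * A \<phi> j)"
  by (auto simp: fin_op_def algebra_simps intro: finite_vec_scale)

lemma fin_op_comp: "fin_op A \<Longrightarrow> fin_op B \<Longrightarrow> fin_op (\<lambda>\<phi>. A (B \<phi>))"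
  by (auto simp: fin_op_def)

lemma fin_op_sum: "finite I \<Longrightarrow> (\<And>k. k \<in> I \<Longrightarrow> fin_op (A k)) \<Longrightarrow> fin_op (\<lambda>\<phi> j. \<Sum>k\<in>I. A k \<phi> j)"
  by (auto simp: fin_op_def sum.distrib sum_distrib_left intro!: finite_vec_sum)

lemma fin_op_funpow: "fin_op A \<Longrightarrow> fin_op (A ^^ n)"
proof (induction n)
  case 0
  show ?case by (simp add: fin_op_def id_def)
next
  case (Suc n)
  then show ?case using fin_op_comp[of A "A ^^ n"] by (simp add: o_def)
qed

text \<open>Formal adjointness, tested on finitely supported vectors where every inner product is a
  finite sum. It is stable under sums, multiples and products, so skewness of the generator can be
  assembled from single modes.\<close>

definition adj :: "(('n, 'x) vec \<Rightarrow> ('n, 'x) vec) \<Rightarrow> (('n, 'x) vec \<Rightarrow> ('n, 'x) vec) \<Rightarrow> bool" where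
  "adj A A' \<longleftrightarrow> fin_op A \<and> fin_op A' \<and>
     (\<forall>\<phi> \<psi>. finite_vec \<phi> \<longrightarrow> finite_vec \<psi> \<longrightarrow> ip (A \<phi>) \<psi> = ip \<phi> (A' \<psi>))"

lemma adjD: "adj A A' \<Longrightarrow> finite_vec \<phi> \<Longrightarrow> finite_vec \<psi> \<Longrightarrow> ip (A \<phi>) \<psi> = ip \<phi> (A' \<psi>)"
  and adj_fin_op: "adj A A' \<Longrightarrow> fin_op A" "adj A A' \<Longrightarrow> fin_op A'"
  by (simp_all add: adj_def)

lemma adj_add: "adj A A' \<Longrightarrow> adj B B' \<Longrightarrow> adj (\<lambda>\<phi> j. A \<phi> j + B \<phi> j) (\<lambda>\<phi> j. A' \<phi> j + B' \<phi> j)"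
  by (auto simp: adj_def fin_op_add ip_add_left ip_add_right fin_op_finite)

lemma adj_scale: "adj A A' \<Longrightarrow> adj (\<lambda>\<phi> j. c * A \<phi> j) (\<lambda>\<phi> j. cnj c * A' \<phi> j)"
  by (auto simp: adj_def fin_op_scale ip_scale_left finite_vec_scale fin_op_mult)

lemma adj_comp: "adj A A' \<Longrightarrow> adj B B' \<Longrightarrow> adj (\<lambda>\<phi>. A (B \<phi>)) (\<lambda>\<phi>. B' (A' \<phi>))"
  by (auto simp: adj_def fin_op_comp fin_op_finite)

lemma adj_sum:
  "finite I \<Longrightarrow> (\<And>k. k \<in> I \<Longrightarrow> adj (A k) (A' k)) \<Longrightarrow> adj (\<lambda>\<phi> j. \<Sum>k\<in>I. A k \<phi> j) (\<lambda>\<phi> j. \<Sum>k\<in>I. A' k \<phi> j)"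
  by (auto simp: adj_def fin_op_sum ip_sum_left ip_sum_right fin_op_finite)

section \<open>Mode operators\<close>

lemma fin_op_ann: "fin_op (ann k :: ('n, 'x) vec \<Rightarrow> _)"
proof -
  let ?u = "\<lambda>(a, b, x). (a(k := Suc (a k)), b, x) :: ('n \<Rightarrow> nat) \<times> ('n \<Rightarrow> nat) \<times> 'x"
  have "inj ?u" by (auto simp: inj_def fun_eq_iff)
  have "finite_vec (ann k \<phi>)" if "finite_vec \<phi>" for \<phi> :: "('n, 'x) vec"
    using finite_vimageI[OF that[unfolded finite_vec_def] \<open>inj ?u\<close>] unfolding finite_vec_def
    by (rule finite_subset[rotated]) (auto simp: ann_def vimage_def)
  then show ?thesis by (auto simp: fin_op_def ann_def fun_eq_iff algebra_simps)
qed

lemma fin_op_cre: "fin_op (cre k :: ('n, 'x) vec \<Rightarrow> _)"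
proof -
  let ?u = "\<lambda>(a, b, x). (a(k := Suc (a k)), b, x) :: ('n \<Rightarrow> nat) \<times> ('n \<Rightarrow> nat) \<times> 'x"
  have "finite_vec (cre k \<phi>)" if "finite_vec \<phi>" for \<phi> :: "('n, 'x) vec"
  proof -
    have "j \<in> ?u ` {j. \<phi> j \<noteq> 0}" if "cre k \<phi> j \<noteq> 0" for j
    proof -
      obtain a b x where j: "j = (a, b, x)" by (cases j)
      with that show ?thesis
        by (intro image_eqI[of _ _ "(a(k := a k - Suc 0), b, x)"]) (auto simp: cre_def split: if_splits)
    qed
    then have "{j. cre k \<phi> j \<noteq> 0} \<subseteq> ?u ` {j. \<phi> j \<noteq> 0}" by blast
    then show ?thesis
      using that unfolding finite_vec_def by (meson finite_imageI finite_subset)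
  qed
  then show ?thesis by (auto simp: fin_op_def cre_def fun_eq_iff algebra_simps)
qed

text \<open>Reindexing along the injection that adds a quantum to mode k; outside its range mode k
  is empty, and there \<open>cre k \<psi>\<close> vanishes.\<close>

lemma adj_ann_cre: "adj (ann k) (cre k :: ('n, 'x) vec \<Rightarrow> _)"
proof -
  let ?u = "\<lambda>(a, b, x). (a(k := Suc (a k)), b, x) :: ('n \<Rightarrow> nat) \<times> ('n \<Rightarrow> nat) \<times> 'x"
  have "inj ?u" by (auto simp: inj_def fun_eq_iff)
  have "ip (ann k \<phi>) \<psi> = ip \<phi> (cre k \<psi>)" for \<phi> \<psi> :: "('n, 'x) vec"
  proof -
    have "ip (ann k \<phi>) \<psi> = infsum ((\<lambda>j. \<phi> j \<bullet> cre k \<psi> j) \<circ> ?u) UNIV"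
      unfolding ip_def by (rule infsum_cong) (auto simp: ann_def cre_def inner_complex_def algebra_simps)
    also have "\<dots> = infsum (\<lambda>j. \<phi> j \<bullet> cre k \<psi> j) (range ?u)"
      by (rule infsum_reindex[OF \<open>inj ?u\<close>, symmetric])
    also have "\<dots> = ip \<phi> (cre k \<psi>)"
    proof -
      have "\<phi> j \<bullet> cre k \<psi> j = 0" if "j \<notin> range ?u" for j
      proof -
        obtain a b x where j: "j = (a, b, x)" by (cases j)
        have "j = ?u (a(k := a k - Suc 0), b, x)" if "0 < a k" using that j by auto
        with \<open>j \<notin> range ?u\<close> have "a k = 0" by blast
        with j show ?thesis by (simp add: cre_def)
      qed
      then show ?thesis unfolding ip_def by (intro infsum_cong_neutral) blast+
    qed
    finally show ?thesis .
  qed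
  then show ?thesis by (simp add: adj_def fin_op_ann fin_op_cre)
qed

text \<open>Exchanges the roles of signal and LO modes, so that facts about LO operators follow from
  those about signal operators by conjugation.\<close>

definition swap :: "('n, 'x) vec \<Rightarrow> ('n, 'x) vec" where
  "swap \<phi> = (\<lambda>(a, b, x). \<phi> (b, a, x))"

lemma annb_swap: "annb k \<phi> = swap (ann k (swap \<phi>))"
  and creb_swap: "creb k \<phi> = swap (cre k (swap \<phi>))"
  by (simp_all add: annb_def creb_def ann_def cre_def swap_def fun_eq_iff)

lemma adj_swap: "adj swap (swap :: ('n, 'x) vec \<Rightarrow> _)"
proof -
  let ?s = "\<lambda>(a, b, x). (b, a, x) :: ('n \<Rightarrow> nat) \<times> ('n \<Rightarrow> nat) \<times> 'x"
  have s: "bij ?s" by (rule o_bij[of ?s]) (auto simp: fun_eq_iff)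
  have sw: "swap \<phi> = (\<lambda>j. \<phi> (?s j))" for \<phi> :: "('n, 'x) vec" by (auto simp: swap_def)
  have "ip (swap \<phi>) \<psi> = ip \<phi> (swap \<psi>)" for \<phi> \<psi> :: "('n, 'x) vec"
    unfolding ip_def
    by (subst infsum_reindex_bij_betw[OF s, of "\<lambda>j. \<phi> j \<bullet> swap \<psi> j", symmetric])
      (auto simp: swap_def intro!: infsum_cong)
  moreover have "fin_op (swap :: ('n, 'x) vec \<Rightarrow> _)"
    using finite_vimageI[OF _ bij_is_inj[OF s]] by (fastforce simp: fin_op_def sw finite_vec_def vimage_def)
  ultimately show ?thesis by (simp add: adj_def)
qed

lemma adj_annb_creb: "adj (annb k) (creb k)"
  using adj_comp[OF adj_swap adj_comp[OF adj_ann_cre adj_swap], of k]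
  by (simp add: annb_swap[abs_def] creb_swap[abs_def])

lemma adj_sym: "adj A B \<Longrightarrow> adj B A"
  by (auto simp: adj_def) (metis ip_commute)

lemma fin_op_annb: "fin_op (annb k)"
  and fin_op_creb: "fin_op (creb k)"
  by (rule adj_fin_op[OF adj_annb_creb])+

subsection \<open>The generator on basis vectors\<close>

text \<open>The factor -i turns formal self-adjointness into real skewness and makes the group the
  exponential of t times \<open>gen\<close>, with real Taylor coefficients.\<close>

definition gen :: "('n::finite \<Rightarrow> complex) \<Rightarrow> real \<Rightarrow> ('n, 'x) vec \<Rightarrow> ('n, 'x) vec" where
  "gen \<alpha> \<delta> \<psi> = (\<lambda>j. - \<i> * qdop \<alpha> \<delta> \<psi> j)"

lemma gen_sum: "gen \<alpha> \<delta> \<psi> = (\<lambda>j. \<Sum>k\<in>UNIV. (- \<alpha> k * cre k \<psi> j + cnj (\<alpha> k) * ann k \<psi> j)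
    + (- \<i> * \<delta> * cre k (annb k \<psi>) j + - \<i> * \<delta> * creb k (ann k \<psi>) j))"
  by (simp add: gen_def qdop_def qop_def fun_eq_iff sum.distrib sum_distrib_left sum_subtractf
      sum_negf algebra_simps)

text \<open>Taking adjoints exchanges creation with annihilation and the two directions of hopping;
  conjugating the coefficients then produces the overall sign.\<close>

lemma adj_gen: "adj (gen \<alpha> \<delta> :: ('n::finite, 'x) vec \<Rightarrow> _) (\<lambda>\<psi> j. - gen \<alpha> \<delta> \<psi> j)"
proof -
  have "adj (gen \<alpha> \<delta> :: ('n, 'x) vec \<Rightarrow> _) (\<lambda>\<psi> j. \<Sum>k\<in>UNIV. (cnj (- \<alpha> k) * ann k \<psi> j + cnj (cnj (\<alpha> k)) * cre k \<psi> j)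
    + (cnj (- \<i> * \<delta>) * creb k (ann k \<psi>) j + cnj (- \<i> * \<delta>) * cre k (annb k \<psi>) j))"
    unfolding gen_sum
    by (intro adj_sum adj_add adj_scale[OF adj_ann_cre] adj_scale[OF adj_sym[OF adj_ann_cre]]
        adj_scale[OF adj_comp[OF adj_sym[OF adj_ann_cre] adj_annb_creb]]
        adj_scale[OF adj_comp[OF adj_sym[OF adj_annb_creb] adj_ann_cre]] finite)
  moreover have "(\<lambda>(\<psi> :: ('n, 'x) vec) j. \<Sum>k\<in>UNIV. (cnj (- \<alpha> k) * ann k \<psi> j + cnj (cnj (\<alpha> k)) * cre k \<psi> j)
    + (cnj (- \<i> * \<delta>) * creb k (ann k \<psi>) j + cnj (- \<i> * \<delta>) * cre k (annb k \<psi>) j))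
    = (\<lambda>\<psi> j. - gen \<alpha> \<delta> \<psi> j)"
    by (simp add: gen_sum fun_eq_iff algebra_simps flip: sum_negf)
  ultimately show ?thesis by simp
qed

lemma fin_op_gen: "fin_op (gen \<alpha> \<delta>)"
  by (rule adj_fin_op(1)[OF adj_gen])

lemma finite_vec_gen_iter: "finite_vec \<phi> \<Longrightarrow> finite_vec ((gen \<alpha> \<delta> ^^ n) \<phi>)"
  by (simp add: fin_op_finite fin_op_funpow fin_op_gen)

lemma Abs_sum:
  "finite I \<Longrightarrow> (\<And>k. k \<in> I \<Longrightarrow> finite_vec (v k)) \<Longrightarrow> Abs_ell2 (\<lambda>j. \<Sum>k\<in>I. v k j) = (\<Sum>k\<in>I. Abs_ell2 (v k))"
proof (induction I rule: finite_induct)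
  case empty
  then show ?case by (simp add: zero_ell2_def)
qed (simp add: Abs_add finite_vec_sum finite_vec_in_l2)

section \<open>Iterates of the generator in the occupation number basis\<close>

definition bas :: "'j \<Rightarrow> 'j \<Rightarrow> complex" where
  "bas j = (\<lambda>i. if i = j then 1 else 0)"

lemma finite_vec_bas: "finite_vec (bas j)"
  unfolding finite_vec_def bas_def by simp

lemma finite_vec_expand: "finite_vec v \<Longrightarrow> v = (\<lambda>i. \<Sum>j | v j \<noteq> 0. v j * bas j i)"
  by (auto simp: fun_eq_iff bas_def finite_vec_def if_distrib cong: if_cong)

lemma norm_bas: "norm (Abs_ell2 (bas j)) = 1" for j :: "('n \<Rightarrow> nat) \<times> ('n \<Rightarrow> nat) \<times> 'x"
proof -
  have "(norm (Abs_ell2 (bas j)))\<^sup>2 = 1"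
    by (subst norm_Abs_sq[OF finite_vec_bas], subst ip_finite[OF finite_vec_bas]) (simp add: bas_def)
  then show ?thesis using power2_eq_iff_nonneg[of "norm (Abs_ell2 (bas j))" 1] by simp
qed

text \<open>For an empty mode the truncated subtraction returns the wrong index, but its coefficient
  is \<open>sqrt 0\<close>.\<close>

lemma ann_bas: "ann k (bas (a, b, x)) = (\<lambda>j. sqrt (real (a k)) * bas (a(k := a k - 1), b, x) j)"
  for a b :: "'n \<Rightarrow> nat" and x :: 'x
proof (rule ext)
  fix j :: "('n \<Rightarrow> nat) \<times> ('n \<Rightarrow> nat) \<times> 'x"
  obtain a' b' x' where j: "j = (a', b', x')" by (cases j)
  show "ann k (bas (a, b, x)) j = sqrt (real (a k)) * bas (a(k := a k - 1), b, x) j"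
  proof (cases "a k = 0")
    case True
    then have "a'(k := Suc (a' k)) \<noteq> a" by auto
    then show ?thesis using True by (simp add: j ann_def bas_def)
  next
    case False
    then have "a'(k := Suc (a' k)) = a \<longleftrightarrow> a' = a(k := a k - 1)" by auto
    then show ?thesis using False by (auto simp: j ann_def bas_def)
  qed
qed

lemma cre_bas: "cre k (bas (a, b, x)) = (\<lambda>j. sqrt (real (a k) + 1) * bas (a(k := Suc (a k)), b, x) j)"
  for a b :: "'n \<Rightarrow> nat" and x :: 'x
proof (rule ext)
  fix j :: "('n \<Rightarrow> nat) \<times> ('n \<Rightarrow> nat) \<times> 'x"
  obtain a' b' x' where j: "j = (a', b', x')" by (cases j)
  show "cre k (bas (a, b, x)) j = sqrt (real (a k) + 1) * bas (a(k := Suc (a k)), b, x) j"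
  proof (cases "a' k = 0")
    case True
    then have "a' \<noteq> a(k := Suc (a k))" by auto
    then show ?thesis using True by (simp add: j cre_def bas_def)
  next
    case False
    then have "a'(k := a' k - 1) = a \<longleftrightarrow> a' = a(k := Suc (a k))" by auto
    then show ?thesis using False by (auto simp: j cre_def bas_def)
  qed
qed

lemma swap_bas: "swap (bas (a, b, x)) = bas (b, a, x)"
  by (auto simp: swap_def bas_def fun_eq_iff)

lemma annb_bas: "annb k (bas (a, b, x)) = (\<lambda>j. sqrt (real (b k)) * bas (a, b(k := b k - 1), x) j)"
  by (simp add: annb_swap swap_bas ann_bas) (auto simp: swap_def bas_def fun_eq_iff)

lemma creb_bas: "creb k (bas (a, b, x)) = (\<lambda>j. sqrt (real (b k) + 1) * bas (a, b(k := Suc (b k)), x) j)"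
  by (simp add: creb_swap swap_bas cre_bas) (auto simp: swap_def bas_def fun_eq_iff)

text \<open>Total number of signal and LO quanta: the linear terms change it by one, hopping
  preserves it.\<close>

definition level :: "('n::finite \<Rightarrow> nat) \<times> ('n \<Rightarrow> nat) \<times> 'x \<Rightarrow> nat" where
  "level = (\<lambda>(a, b, x). (\<Sum>k\<in>UNIV. a k) + (\<Sum>k\<in>UNIV. b k))"

lemma sum_upd: "(\<Sum>l\<in>UNIV. (a(k := m)) l) + a k = (\<Sum>l\<in>UNIV. a l) + (m::nat)" for a :: "'n::finite \<Rightarrow> nat"
proof -
  have "(\<Sum>l\<in>UNIV. (a(k := m)) l) = m + (\<Sum>l\<in>UNIV - {k}. a l)"
    by (subst sum.remove[of _ k]) auto
  moreover have "(\<Sum>l\<in>UNIV. a l) = a k + (\<Sum>l\<in>UNIV - {k}. a l)"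
    by (subst sum.remove[of _ k]) auto
  ultimately show ?thesis by simp
qed

text \<open>One application of the generator is peeled off on the inside, and the induction
  hypothesis is used at the resulting basis vectors. Each \<alpha>_k occurs with a creation and an
  annihilation term, and each mode has two hopping terms: hence the two factors 2. Since m only
  bounds the level from above, lowering terms are charged to m + 1 as well.\<close>

lemma norm_gen_iter_bas_le:
  fixes j :: "('n::finite \<Rightarrow> nat) \<times> ('n \<Rightarrow> nat) \<times> 'x"
  assumes "0 \<le> \<delta>" "level j \<le> m"
  shows "norm (Abs_ell2 ((gen \<alpha> \<delta> ^^ n) (bas j)))
    \<le> majorant (2 * (\<Sum>k\<in>UNIV. cmod (\<alpha> k))) (2 * \<delta> * CARD('n)) n m"
  using assms(2)
proof (induction n arbitrary: j m)
  case 0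
  then show ?case by (simp add: norm_bas)
next
  case (Suc n)
  let ?M = "majorant (2 * (\<Sum>k\<in>UNIV. cmod (\<alpha> k))) (2 * \<delta> * CARD('n)) n"
  have M: "0 \<le> ?M m" for m using \<open>0 \<le> \<delta>\<close> by (intro majorant_nonneg) (auto intro: sum_nonneg)
  \<comment> \<open>A seminorm on finitely supported vectors: the norm after the remaining n
    iterations.\<close>
  define N where "N \<phi> = norm (Abs_ell2 ((gen \<alpha> \<delta> ^^ n) \<phi>))" for \<phi> :: "('n, 'x) vec"
  have l2: "in_l2 ((gen \<alpha> \<delta> ^^ n) \<phi>)" if "finite_vec \<phi>" for \<phi> :: "('n, 'x) vec"
    using that by (simp add: finite_vec_gen_iter finite_vec_in_l2)
  have N_add: "N (\<lambda>j. \<phi> j + \<psi> j) \<le> N \<phi> + N \<psi>" if "finite_vec \<phi>" "finite_vec \<psi>" for \<phi> \<psi>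
    using that by (simp add: N_def fin_op_plus[OF fin_op_funpow[OF fin_op_gen]] Abs_add l2 norm_triangle_ineq)
  have N_scale: "N (\<lambda>j. c * \<phi> j) = cmod c * N \<phi>" if "finite_vec \<phi>" for c \<phi>
    using that by (simp add: N_def fin_op_mult[OF fin_op_funpow[OF fin_op_gen]] Abs_scale l2 norm_cscale)
  have N_sum: "N (\<lambda>j. \<Sum>k\<in>I. \<phi> k j) \<le> (\<Sum>k\<in>I. N (\<phi> k))"
    if "finite I" "\<And>k. finite_vec (\<phi> k)" for I :: "'n set" and \<phi>
    using that(1)
  proof (induction I rule: finite_induct)
    case empty
    have "N (\<lambda>j. 0 * bas undefined j) = 0" by (subst N_scale) (simp_all add: finite_vec_bas)
    then show ?case by simp
  next
    case (insert k I)
    then show ?case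
      using N_add[of "\<phi> k" "\<lambda>j. \<Sum>k\<in>I. \<phi> k j"] finite_vec_sum[of I \<phi>] that(2) by simp
  qed
  obtain a b x where j: "j = (a, b, x)" by (cases j)
  have le_m: "a k \<le> m" "b k \<le> m" "a k + b k \<le> m" for k
    using member_le_sum[of k UNIV a] member_le_sum[of k UNIV b] Suc.prems by (auto simp: j level_def)
  have IH: "N (bas i) \<le> ?M m'" if "level i \<le> m'" for i m'
    using Suc.IH[OF that] by (simp add: N_def)
  have lin_bound: "N (\<lambda>i. sqrt r * bas i' i) \<le> sqrt (real m + 1) * ?M (Suc m)"
    if "r \<le> real m + 1" "0 \<le> r" "level i' \<le> Suc m" for r i'
    unfolding N_scale[OF finite_vec_bas] using that IH[of i' "Suc m"] M[of "Suc m"]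
    by (intro mult_mono) (auto simp: N_def)
  \<comment> \<open>The alternative r' = 0 covers hopping out of an empty mode: there the index
    obtained has one quantum too many, but the term vanishes.\<close>
  have hop_bound: "N (\<lambda>i. sqrt r * (sqrt r' * bas i' i)) \<le> (real m + 1) * ?M m"
    if "r \<le> real m + 1" "r' \<le> real m + 1" "0 \<le> r" "0 \<le> r'" "r' = 0 \<or> level i' \<le> m" for r r' i'
  proof -
    have "N (\<lambda>i. sqrt r * (sqrt r' * bas i' i)) = sqrt r * sqrt r' * N (bas i')"
      using that by (subst N_scale, simp add: finite_vec_bas finite_vec_scale, subst N_scale)
        (simp_all add: finite_vec_bas)
    also have "\<dots> \<le> sqrt (real m + 1) * sqrt (real m + 1) * ?M m"
    proof (cases "r' = 0")
      case False
      then show ?thesis using that IH[of i' m] M[of m] by (intro mult_mono) (auto simp: N_def)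
    qed (simp add: M)
    finally show ?thesis by simp
  qed
  have 1: "N (cre k (bas j)) \<le> sqrt (real m + 1) * ?M (Suc m)" for k
    unfolding j cre_bas using le_m[of k] Suc.prems sum_upd[of a k "Suc (a k)"]
    by (intro lin_bound) (auto simp: j level_def)
  have 2: "N (ann k (bas j)) \<le> sqrt (real m + 1) * ?M (Suc m)" for k
    unfolding j ann_bas using le_m[of k] Suc.prems sum_upd[of a k "a k - 1"]
    by (intro lin_bound) (auto simp: j level_def)
  have 3: "N (cre k (annb k (bas j))) \<le> (real m + 1) * ?M m" for k
    unfolding j annb_bas fin_op_mult[OF fin_op_cre] cre_bas
    using le_m[of k] Suc.prems sum_upd[of a k "Suc (a k)"] sum_upd[of b k "b k - 1"]
    by (subst mult.left_commute, intro hop_bound) (auto simp: j level_def)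
  have 4: "N (creb k (ann k (bas j))) \<le> (real m + 1) * ?M m" for k
    unfolding j ann_bas fin_op_mult[OF fin_op_creb] creb_bas
    using le_m[of k] Suc.prems sum_upd[of b k "Suc (b k)"] sum_upd[of a k "a k - 1"]
    by (subst mult.left_commute, intro hop_bound) (auto simp: j level_def)
  note fin = fin_op_finite[OF fin_op_cre] fin_op_finite[OF fin_op_ann] finite_vec_bas
    fin_op_finite[OF fin_op_creb]
    fin_op_finite[OF fin_op_annb]
  have "norm (Abs_ell2 ((gen \<alpha> \<delta> ^^ Suc n) (bas j))) = N (gen \<alpha> \<delta> (bas j))"
    by (simp add: N_def funpow_swap1)
  also have "\<dots> \<le> (\<Sum>k\<in>UNIV. N (\<lambda>i. (- \<alpha> k * cre k (bas j) i + cnj (\<alpha> k) * ann k (bas j) i)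
    + (- \<i> * \<delta> * cre k (annb k (bas j)) i + - \<i> * \<delta> * creb k (ann k (bas j)) i)))"
    unfolding gen_sum by (rule N_sum[OF finite]) (intro finite_vec_add finite_vec_scale fin)
  also have "\<dots> \<le> (\<Sum>k\<in>UNIV. (cmod (\<alpha> k) * (sqrt (real m + 1) * ?M (Suc m))
        + cmod (\<alpha> k) * (sqrt (real m + 1) * ?M (Suc m)))
      + (\<delta> * ((real m + 1) * ?M m) + \<delta> * ((real m + 1) * ?M m)))"
  proof (rule sum_mono)
    fix k
    have s: "N (\<lambda>i. c * \<phi> i) \<le> d * B" if "cmod c = d" "N \<phi> \<le> B" "finite_vec \<phi>" for c d B \<phi>
      using that N_scale[of \<phi> c] by (auto intro: mult_left_mono)
    show "N (\<lambda>i. (- \<alpha> k * cre k (bas j) i + cnj (\<alpha> k) * ann k (bas j) i)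
      + (- \<i> * \<delta> * cre k (annb k (bas j)) i + - \<i> * \<delta> * creb k (ann k (bas j)) i))
      \<le> (cmod (\<alpha> k) * (sqrt (real m + 1) * ?M (Suc m))
        + cmod (\<alpha> k) * (sqrt (real m + 1) * ?M (Suc m)))
      + (\<delta> * ((real m + 1) * ?M m) + \<delta> * ((real m + 1) * ?M m))"
      using \<open>0 \<le> \<delta>\<close>
      by (intro order_trans[OF N_add] add_mono s 1 2 3 4 finite_vec_add finite_vec_scale fin)
        (simp_all add: norm_mult)
  qed
  also have "\<dots> = majorant (2 * (\<Sum>k\<in>UNIV. cmod (\<alpha> k))) (2 * \<delta> * CARD('n)) (Suc n) m"
    by (simp add: sum.distrib mult.assoc flip: sum_distrib_left sum_distrib_right)
  finally show ?case .
qed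

text \<open>A finite expansion in basis vectors reduces the claim to finitely many majorant series,
  one for each level that occurs.\<close>

lemma entire_gen:
  fixes v :: "('n::finite, 'x) vec"
  assumes "0 \<le> \<delta>" "0 \<le> t" "finite_vec v"
  shows "summable (\<lambda>n. t ^ n / fact n * norm (Abs_ell2 ((gen \<alpha> \<delta> ^^ n) v)))"
proof (rule summable_comparison_test)
  let ?M = "majorant (2 * (\<Sum>k\<in>UNIV. cmod (\<alpha> k))) (2 * \<delta> * CARD('n))"
  let ?S = "{j. v j \<noteq> 0}"
  have fin: "finite ?S" using assms(3) by (simp add: finite_vec_def)
  show "summable (\<lambda>n. \<Sum>j\<in>?S. cmod (v j) * (t ^ n / fact n * ?M n (level j)))"
    using assms by (intro summable_sum summable_mult summable_majorant) (auto intro: sum_nonneg)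
  show "\<exists>N. \<forall>n\<ge>N. norm (t ^ n / fact n * norm (Abs_ell2 ((gen \<alpha> \<delta> ^^ n) v)))
      \<le> (\<Sum>j\<in>?S. cmod (v j) * (t ^ n / fact n * ?M n (level j)))"
  proof (intro exI allI impI)
    fix n
    have "(gen \<alpha> \<delta> ^^ n) v = (\<lambda>i. \<Sum>j\<in>?S. v j * (gen \<alpha> \<delta> ^^ n) (bas j) i)"
      using fin_op_lincomb[OF fin_op_funpow[OF fin_op_gen] fin, of n \<alpha> \<delta> v bas]
        finite_vec_expand[OF assms(3)] by metis
    then have "Abs_ell2 ((gen \<alpha> \<delta> ^^ n) v) = (\<Sum>j\<in>?S. cscale (v j) (Abs_ell2 ((gen \<alpha> \<delta> ^^ n) (bas j))))"
      using fin by (simp add: Abs_sum finite_vec_scale finite_vec_gen_iter finite_vec_bas Abs_scale finite_vec_in_l2)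
    then have "norm (Abs_ell2 ((gen \<alpha> \<delta> ^^ n) v)) \<le> (\<Sum>j\<in>?S. cmod (v j) * ?M n (level j))"
      using norm_gen_iter_bas_le[OF assms(1) order.refl]
      by (auto intro!: order_trans[OF norm_sum] sum_mono mult_left_mono simp: norm_cscale)
    then have "t ^ n / fact n * norm (Abs_ell2 ((gen \<alpha> \<delta> ^^ n) v))
        \<le> t ^ n / fact n * (\<Sum>j\<in>?S. cmod (v j) * ?M n (level j))"
      using assms(2) by (intro mult_left_mono) auto
    then show "norm (t ^ n / fact n * norm (Abs_ell2 ((gen \<alpha> \<delta> ^^ n) v)))
      \<le> (\<Sum>j\<in>?S. cmod (v j) * (t ^ n / fact n * ?M n (level j)))"
      using assms(2) by (simp add: sum_distrib_left mult.left_commute)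
  qed
qed

subsection \<open>Existence of the groups\<close>

definition fin_space :: "(('n \<Rightarrow> nat) \<times> ('n \<Rightarrow> nat) \<times> 'x) ell2 set" where
  "fin_space = {h. finite_vec (coord h)}"

text \<open>Meaningful on \<open>fin_space\<close>; elsewhere the image under \<open>gen\<close> may
  fail to be square-summable.\<close>

definition gen_ell2 :: "('n::finite \<Rightarrow> complex) \<Rightarrow> real \<Rightarrow>
    (('n \<Rightarrow> nat) \<times> ('n \<Rightarrow> nat) \<times> 'x) ell2 \<Rightarrow> (('n \<Rightarrow> nat) \<times> ('n \<Rightarrow> nat) \<times> 'x) ell2" where
  "gen_ell2 \<alpha> \<delta> h = Abs_ell2 (gen \<alpha> \<delta> (coord h))"

lemma Abs_in_fin_space: "finite_vec v \<Longrightarrow> Abs_ell2 v \<in> fin_space"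
  by (simp add: fin_space_def coord_finite_vec)

lemma gen_ell2_iter: "finite_vec v \<Longrightarrow> (gen_ell2 \<alpha> \<delta> ^^ n) (Abs_ell2 v) = Abs_ell2 ((gen \<alpha> \<delta> ^^ n) v)"
  by (induction n) (simp_all add: gen_ell2_def coord_finite_vec finite_vec_gen_iter)

lemma fin_spaceE:
  assumes "h \<in> fin_space"
  obtains v where "finite_vec v" "h = Abs_ell2 v"
  using assms coord_inverse[of h] by (auto simp: fin_space_def)

definition restrict_vec :: "'j set \<Rightarrow> ('j \<Rightarrow> complex) \<Rightarrow> 'j \<Rightarrow> complex" where
  "restrict_vec F v = (\<lambda>j. if j \<in> F then v j else 0)"

lemma finite_vec_restrict: "finite F \<Longrightarrow> finite_vec (restrict_vec F v)"
  unfolding finite_vec_def restrict_vec_def by (rule finite_subset[of _ F]) auto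

text \<open>The squared error is the tail of the sum of squares. Truncation is preferred to an
  arbitrary approximation because it does not increase the norm or the expected number of quanta and
  preserves the LO vacuum.\<close>

lemma restrict_approx:
  fixes x :: "(('n \<Rightarrow> nat) \<times> ('n \<Rightarrow> nat) \<times> 'x) ell2"
  assumes "0 < e"
  obtains F where "finite F" "norm (Abs_ell2 (restrict_vec F (coord x)) - x) < e"
    "norm (Abs_ell2 (restrict_vec F (coord x))) \<le> norm x"
proof -
  let ?f = "\<lambda>j. (cmod (coord x j))\<^sup>2"
  have "((\<lambda>F. sum ?f F) \<longlongrightarrow> (norm x)\<^sup>2) (finite_subsets_at_top UNIV)"
    unfolding norm_ell2_sq by (rule infsum_tendsto[OF coord_summable])
  then have "\<forall>\<^sub>F F in finite_subsets_at_top UNIV. (norm x)\<^sup>2 - e\<^sup>2 < sum ?f F"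
    by (rule order_tendstoD) (use assms in simp)
  then obtain F where F: "finite F" "(norm x)\<^sup>2 - e\<^sup>2 < sum ?f F"
    unfolding eventually_finite_subsets_at_top by blast
  let ?y = "Abs_ell2 (restrict_vec F (coord x))"
  have y: "coord ?y = restrict_vec F (coord x)"
    by (simp add: coord_finite_vec finite_vec_restrict F)
  have "(norm (?y - x))\<^sup>2 = infsum ?f (UNIV - F)"
    unfolding norm_ell2_sq by (rule infsum_cong_neutral) (simp_all add: minus_ell2.rep_eq y, auto simp: restrict_vec_def)
  also have "\<dots> = (norm x)\<^sup>2 - sum ?f F"
    using F(1) by (simp add: infsum_Diff coord_summable norm_ell2_sq)
  finally have 1: "(norm (?y - x))\<^sup>2 = (norm x)\<^sup>2 - sum ?f F" .
  then have "(norm (?y - x))\<^sup>2 < e\<^sup>2" using F(2) by simp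
  then have "norm (?y - x) < e" using assms by (simp add: power_less_imp_less_base)
  moreover have "norm ?y \<le> norm x"
  proof (rule norm_ell2_le)
    fix G :: "(('n \<Rightarrow> nat) \<times> ('n \<Rightarrow> nat) \<times> 'x) set" assume "finite G"
    have "(\<Sum>i\<in>G. (cmod (coord ?y i))\<^sup>2) \<le> (\<Sum>i\<in>G. ?f i)"
      by (intro sum_mono) (simp add: y, simp add: restrict_vec_def)
    also have "\<dots> \<le> (norm x)\<^sup>2" by (rule sum_coord_le[OF \<open>finite G\<close>])
    finally show "(\<Sum>i\<in>G. (cmod (coord ?y i))\<^sup>2) \<le> (norm x)\<^sup>2" .
  qed simp
  ultimately show ?thesis using that F(1) by blast
qed

lemma closure_fin_space: "closure fin_space = UNIV"
proof -
  have "x \<in> closure fin_space" for x :: "(('n \<Rightarrow> nat) \<times> ('n \<Rightarrow> nat) \<times> 'x) ell2"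
    unfolding closure_approachable dist_norm
    by (meson restrict_approx[of _ x] Abs_in_fin_space finite_vec_restrict)
  then show ?thesis by blast
qed

lemma entire_skew_gen:
  assumes "0 \<le> \<delta>"
  shows "entire_skew fin_space (gen_ell2 \<alpha> \<delta>)"
proof
  show "subspace fin_space"
    unfolding subspace_def fin_space_def
    by (auto simp: plus_ell2.rep_eq scaleR_ell2.rep_eq zero_ell2.rep_eq finite_vec_add finite_vec_scale)
      (simp add: finite_vec_def)
next
  fix v w :: "(('a \<Rightarrow> nat) \<times> ('a \<Rightarrow> nat) \<times> 'b) ell2" and c t :: real
  assume v: "v \<in> fin_space"
  then obtain v' where v': "finite_vec v'" "v = Abs_ell2 v'" by (rule fin_spaceE)
  note fv = fin_op_finite[OF fin_op_gen] coord_finite_vec finite_vec_in_l2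
  show "gen_ell2 \<alpha> \<delta> v \<in> fin_space"
    by (simp add: gen_ell2_def v' fv Abs_in_fin_space)
  show "gen_ell2 \<alpha> \<delta> (c *\<^sub>R v) = c *\<^sub>R gen_ell2 \<alpha> \<delta> v"
    by (simp add: gen_ell2_def v' fv scaleR_ell2.rep_eq fin_op_mult[OF fin_op_gen] Abs_scale cscale_real)
  show "0 \<le> t \<Longrightarrow> summable (\<lambda>n. t ^ n / fact n * norm ((gen_ell2 \<alpha> \<delta> ^^ n) v))"
    using entire_gen[OF assms _ v'(1)] by (simp add: v' gen_ell2_iter)
  assume w: "w \<in> fin_space"
  then obtain w' where w': "finite_vec w'" "w = Abs_ell2 w'" by (rule fin_spaceE)
  show "gen_ell2 \<alpha> \<delta> (v + w) = gen_ell2 \<alpha> \<delta> v + gen_ell2 \<alpha> \<delta> w"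
    by (simp add: gen_ell2_def v' w' fv plus_ell2.rep_eq fin_op_plus[OF fin_op_gen] Abs_add)
  have "gen_ell2 \<alpha> \<delta> v \<bullet> w = ip (gen \<alpha> \<delta> v') w'"
    by (simp add: gen_ell2_def v' w' fv ip_Abs)
  also have "\<dots> = ip v' (\<lambda>j. - gen \<alpha> \<delta> w' j)"
    by (rule adjD[OF adj_gen v'(1) w'(1)])
  also have "\<dots> = ip v' (\<lambda>j. - 1 * gen \<alpha> \<delta> w' j)" by simp
  also have "\<dots> = Abs_ell2 v' \<bullet> Abs_ell2 (\<lambda>j. -1 * gen \<alpha> \<delta> w' j)"
    by (intro ip_Abs[symmetric] finite_vec_scale) (simp_all add: v' w' fv)
  also have "Abs_ell2 (\<lambda>j. -1 * gen \<alpha> \<delta> w' j) = - gen_ell2 \<alpha> \<delta> w"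
    using cscale_real[of "-1" "Abs_ell2 (gen \<alpha> \<delta> w')"] by (subst Abs_scale) (simp_all add: gen_ell2_def w' fv)
  finally show "gen_ell2 \<alpha> \<delta> v \<bullet> w = - (v \<bullet> gen_ell2 \<alpha> \<delta> w)" by (simp add: v')
qed (fact closure_fin_space)

text \<open>Links vector derivatives to the difference quotient in the last clause of
  \<open>generated_group\<close>.\<close>

lemma has_vector_derivative_0_iff:
  fixes f :: "real \<Rightarrow> 'h::real_normed_vector"
  shows "(f has_vector_derivative c) (at 0) \<longleftrightarrow> ((\<lambda>t. norm ((f t - f 0) /\<^sub>R t - c)) \<longlongrightarrow> 0) (at 0)"
proof -
  have "norm (f t - f 0 - t *\<^sub>R c) / norm t = norm ((f t - f 0) /\<^sub>R t - c)" if "t \<noteq> 0" for t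
  proof -
    have "(f t - f 0) /\<^sub>R t - c = (f t - f 0 - t *\<^sub>R c) /\<^sub>R t"
      using that by (simp add: scaleR_diff_right)
    then show ?thesis by (simp add: divide_inverse mult.commute)
  qed
  then have "((\<lambda>t. norm (f t - f 0 - t *\<^sub>R c) / norm t) \<longlongrightarrow> 0) (at 0)
      \<longleftrightarrow> ((\<lambda>t. norm ((f t - f 0) /\<^sub>R t - c)) \<longlongrightarrow> 0) (at 0)"
    by (intro tendsto_cong) (auto simp: eventually_at_filter)
  then show ?thesis
    by (simp add: has_vector_derivative_def has_derivative_at bounded_linear_scaleR_left)
qed

lemma l2norm_difference_quotient:
  assumes "finite_vec v" "in_l2 w"
  shows "l2norm (\<lambda>j. (w j - v j) / complex_of_real t + \<i> * qdop \<alpha> \<delta> v j)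
    = norm ((Abs_ell2 w - Abs_ell2 v) /\<^sub>R t - Abs_ell2 (gen \<alpha> \<delta> v))"
proof -
  have "(\<lambda>j. (w j - v j) / complex_of_real t + \<i> * qdop \<alpha> \<delta> v j)
    = coord ((Abs_ell2 w - Abs_ell2 v) /\<^sub>R t - Abs_ell2 (gen \<alpha> \<delta> v))"
    using assms fin_op_finite[OF fin_op_gen assms(1), of \<alpha> \<delta>]
    by (simp add: fun_eq_iff minus_ell2.rep_eq scaleR_ell2.rep_eq coord_Abs coord_finite_vec gen_def
        divide_inverse mult.commute)
  then show ?thesis by (simp add: l2norm_coord)
qed

text \<open>The witness is the extended exponential series read in coordinates. Surjectivity comes
  from the inverse at time -t, complex linearity from commutation with
  \<open>cscale\<close>.\<close>

lemma generated_group_exists: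
  fixes \<alpha> :: "'n::finite \<Rightarrow> complex"
  assumes "0 \<le> \<delta>"
  shows "\<exists>U :: real \<Rightarrow> ('n, 'x) vec \<Rightarrow> ('n, 'x) vec. generated_group (qdop \<alpha> \<delta>) U"
proof -
  interpret entire_skew "fin_space :: (('n \<Rightarrow> nat) \<times> ('n \<Rightarrow> nat) \<times> 'x) ell2 set" "gen_ell2 \<alpha> \<delta>"
    by (rule entire_skew_gen[OF assms])
  have U_cscale: "U t (cscale c x) = cscale c (U t x)" for t c and x :: "(('n \<Rightarrow> nat) \<times> ('n \<Rightarrow> nat) \<times> 'x) ell2"
  proof (rule U_commute[OF bounded_linear_cscale])
    fix v :: "(('n \<Rightarrow> nat) \<times> ('n \<Rightarrow> nat) \<times> 'x) ell2" assume "v \<in> fin_space"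
    then obtain v' where v': "finite_vec v'" "v = Abs_ell2 v'" by (rule fin_spaceE)
    show "cscale c v \<in> fin_space"
      by (simp add: v' fin_space_def cscale.rep_eq coord_finite_vec finite_vec_scale)
    show "gen_ell2 \<alpha> \<delta> (cscale c v) = cscale c (gen_ell2 \<alpha> \<delta> v)"
      using v'(1) by (simp add: v'(2) gen_ell2_def cscale.rep_eq coord_finite_vec fin_op_mult[OF fin_op_gen]
          Abs_scale finite_vec_in_l2 fin_op_finite[OF fin_op_gen])
  qed
  define W where "W t \<psi> = coord (U t (Abs_ell2 \<psi>))" for t \<psi>
  have l2sq_W: "l2sq (W t \<psi>) = l2sq \<psi>" if "in_l2 \<psi>" for t \<psi>
    using that norm_l2sq[of "Abs_ell2 \<psi>"] by (simp add: W_def norm_l2sq norm_U coord_Abs)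
  have W_lin: "W t (\<lambda>j. c * \<psi> j + \<phi> j) = (\<lambda>j. c * W t \<psi> j + W t \<phi> j)" if "in_l2 \<psi>" "in_l2 \<phi>" for t c \<psi> \<phi>
    using that by (simp add: W_def Abs_add Abs_scale in_l2_scale linear_add[OF linear_U] U_cscale
        plus_ell2.rep_eq cscale.rep_eq)
  have W_surj: "\<exists>\<psi>. in_l2 \<psi> \<and> W t \<psi> = \<phi>" if "in_l2 \<phi>" for t \<phi>
    using that U_add[of t "- t" "Abs_ell2 \<phi>"]
    by (intro exI[of _ "W (- t) \<phi>"]) (simp add: W_def in_l2_coord coord_inverse coord_Abs)
  have W_cont: "((\<lambda>t. l2norm (\<lambda>j. W t \<psi> j - W t0 \<psi> j)) \<longlongrightarrow> 0) (at t0)" for t0 \<psi>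
  proof -
    have "l2norm (\<lambda>j. W t \<psi> j - W t0 \<psi> j) = norm (U t (Abs_ell2 \<psi>) - U t0 (Abs_ell2 \<psi>))" for t
      by (simp add: W_def flip: minus_ell2.rep_eq l2norm_coord)
    then show ?thesis
      using tendsto_norm_zero[OF LIM_zero[OF U_strong[of "Abs_ell2 \<psi>" t0]]] by simp
  qed
  have W_deriv: "((\<lambda>t. l2norm (\<lambda>j. (W t v j - v j) / complex_of_real t + \<i> * qdop \<alpha> \<delta> v j)) \<longlongrightarrow> 0) (at 0)"
    if "finite_vec v" for v
  proof -
    have "((\<lambda>t. U t (Abs_ell2 v)) has_vector_derivative Abs_ell2 (gen \<alpha> \<delta> v)) (at 0)"
      using V_deriv[OF Abs_in_fin_space[OF that], of 0] that
      by (simp add: U_eq_V Abs_in_fin_space gen_ell2_def coord_finite_vec)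
    then show ?thesis
      using that by (simp add: has_vector_derivative_0_iff l2norm_difference_quotient W_def in_l2_coord coord_inverse)
  qed
  have "generated_group (qdop \<alpha> \<delta>) W"
    unfolding generated_group_def
    using l2sq_W W_lin W_surj W_cont W_deriv
    by (auto simp: W_def in_l2_coord coord_Abs coord_inverse U_add)
  then show ?thesis by blast
qed

lemma exp_group_generated: "0 \<le> \<delta> \<Longrightarrow> generated_group (qdop \<alpha> \<delta>) (exp_group (qdop \<alpha> \<delta>))"
  unfolding exp_group_def using generated_group_exists by (rule someI_ex)

text \<open>Any group meeting the specification is moved to \<open>ell2\<close>, where derivatives
  are available; this will apply to the chosen \<open>exp_group\<close>.\<close>

definition lift_group :: "(real \<Rightarrow> ('n, 'x) vec \<Rightarrow> ('n, 'x) vec) \<Rightarrow> real \<Rightarrow>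
    (('n \<Rightarrow> nat) \<times> ('n \<Rightarrow> nat) \<times> 'x) ell2 \<Rightarrow> (('n \<Rightarrow> nat) \<times> ('n \<Rightarrow> nat) \<times> 'x) ell2" where
  "lift_group U t x = Abs_ell2 (U t (coord x))"

context
  fixes \<alpha> :: "'n::finite \<Rightarrow> complex" and \<delta> :: real and U :: "real \<Rightarrow> ('n, 'x) vec \<Rightarrow> ('n, 'x) vec"
  assumes U: "generated_group (qdop \<alpha> \<delta>) U"
begin

lemma coord_lift_group: "coord (lift_group U t x) = U t (coord x)"
  using U by (simp add: generated_group_def lift_group_def coord_Abs in_l2_coord)

lemma norm_lift_group: "norm (lift_group U t x) = norm x"
proof -
  have "l2sq (U t (coord x)) = l2sq (coord x)"
    using U by (simp add: generated_group_def in_l2_coord)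
  then have "l2norm (coord (lift_group U t x)) = l2norm (coord x)"
    by (simp add: coord_lift_group l2norm_def)
  then show ?thesis by (simp add: l2norm_coord)
qed

lemma linear_lift_group: "linear (lift_group U t)"
proof -
  have *: "U t (\<lambda>j. c * coord x j + coord y j) = (\<lambda>j. c * U t (coord x) j + U t (coord y) j)" for c x y
    using U by (simp add: generated_group_def in_l2_coord)
  have "U t (\<lambda>j. 0) = (\<lambda>j. 0)"
    \<comment> \<open>The specification combines scaling and addition in one clause; the factor -1
      with both vectors zero extracts the value at 0.\<close>
    using *[of "-1" 0 0] by (simp add: zero_ell2.rep_eq)
  then show ?thesis
    using *[of 1] *[of "of_real _" _ 0]
    by (intro linearI; intro coord_inject[THEN iffD1])
      (simp_all add: coord_lift_group plus_ell2.rep_eq scaleR_ell2.rep_eq zero_ell2.rep_eq)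
qed

lemma lift_group_0: "lift_group U 0 x = x"
  using U by (simp add: generated_group_def lift_group_def in_l2_coord coord_inverse)

lemma lift_group_add: "lift_group U (s + t) x = lift_group U s (lift_group U t x)"
proof -
  have "U (s + t) (coord x) = U s (U t (coord x))"
    using U by (simp add: generated_group_def in_l2_coord)
  then show ?thesis
    by (intro coord_inject[THEN iffD1]) (simp add: coord_lift_group)
qed

lemma lift_group_deriv:
  assumes "finite_vec v"
  shows "((\<lambda>t. lift_group U t (Abs_ell2 v)) has_vector_derivative Abs_ell2 (gen \<alpha> \<delta> v)) (at 0)"
proof -
  have "((\<lambda>t. l2norm (\<lambda>j. (U t v j - v j) / complex_of_real t + \<i> * qdop \<alpha> \<delta> v j)) \<longlongrightarrow> 0) (at 0)"
    using U assms by (simp add: generated_group_def)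
  moreover have "in_l2 (U t v)" for t
    using U finite_vec_in_l2[OF assms] by (simp add: generated_group_def)
  ultimately show ?thesis
    by (simp add: has_vector_derivative_0_iff l2norm_difference_quotient assms lift_group_0)
      (simp add: lift_group_def coord_finite_vec assms)
qed

end

subsection \<open>Commutation relations and comparison of the two groups\<close>

text \<open>The operator T of the overview; \<open>pump\<close> below is its \<beta>.\<close>

definition hop :: "('n::finite, 'x) vec \<Rightarrow> ('n, 'x) vec" where
  "hop \<psi> = (\<lambda>j. \<Sum>k\<in>UNIV. creb k (ann k \<psi>) j)"

definition pump :: "('n::finite \<Rightarrow> complex) \<Rightarrow> ('n, 'x) vec \<Rightarrow> ('n, 'x) vec" where
  "pump \<alpha> \<psi> = (\<lambda>j. \<Sum>k\<in>UNIV. \<alpha> k * creb k \<psi> j)"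

lemma fin_op_hop: "fin_op (hop :: ('n::finite, 'x) vec \<Rightarrow> _)"
  unfolding hop_def by (intro fin_op_sum fin_op_comp[OF fin_op_creb fin_op_ann] finite)

lemma fin_op_pump: "fin_op (pump \<alpha> :: ('n::finite, 'x) vec \<Rightarrow> _)"
  unfolding pump_def by (intro fin_op_sum fin_op_scale[OF fin_op_creb] finite)

section \<open>Canonical commutation relations\<close>

lemma sqrt_sqrt_mult: "0 \<le> r \<Longrightarrow> complex_of_real (sqrt r) * (complex_of_real (sqrt r) * z) = of_real r * z"
  by (simp flip: mult.assoc of_real_mult)

lemma ann_cre: "ann k (cre l \<psi>) = (\<lambda>j. cre l (ann k \<psi>) j + (if k = l then \<psi> j else 0))"
proof (rule ext)
  fix j :: "('a \<Rightarrow> nat) \<times> ('a \<Rightarrow> nat) \<times> 'b"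
  obtain a b x where j: "j = (a, b, x)" by (cases j)
  show "ann k (cre l \<psi>) j = cre l (ann k \<psi>) j + (if k = l then \<psi> j else 0)"
  proof (cases "k = l")
    case True
    then show ?thesis by (auto simp: j ann_def cre_def sqrt_sqrt_mult distrib_right)
  next
    case False
    then show ?thesis by (simp add: j ann_def cre_def fun_upd_twist)
  qed
qed

lemma ann_ann: "ann k (ann l \<psi>) = ann l (ann k \<psi>)"
  by (cases "k = l") (auto simp: ann_def fun_eq_iff fun_upd_twist)

lemma creb_cre: "creb k (cre l \<psi>) = cre l (creb k \<psi>)"
  by (auto simp: creb_def cre_def fun_eq_iff)

lemma creb_ann: "creb k (ann l \<psi>) = ann l (creb k \<psi>)"
  by (auto simp: creb_def ann_def fun_eq_iff)

lemma gen_0_sum: "gen \<alpha> 0 \<psi> = (\<lambda>j. \<Sum>k\<in>UNIV. - \<alpha> k * cre k \<psi> j + cnj (\<alpha> k) * ann k \<psi> j)"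
  by (simp add: gen_sum)

text \<open>Only the creation term of mode k fails to commute with \<open>ann k\<close>, and it
  contributes the scalar -\<alpha>_k.\<close>

lemma ann_gen_0: "ann k (gen \<alpha> 0 \<psi>) = (\<lambda>j. gen \<alpha> 0 (ann k \<psi>) j - \<alpha> k * \<psi> j)"
proof -
  have "ann k (gen \<alpha> 0 \<psi>) = (\<lambda>j. \<Sum>l\<in>UNIV. - \<alpha> l * (cre l (ann k \<psi>) j + (if k = l then \<psi> j else 0))
      + cnj (\<alpha> l) * ann l (ann k \<psi>) j)"
    unfolding gen_0_sum
    by (simp only: fin_op_sum_apply[OF fin_op_ann finite] fin_op_plus[OF fin_op_ann] fin_op_mult[OF fin_op_ann]
        ann_cre ann_ann[of k])
  also have "\<dots> = (\<lambda>j. gen \<alpha> 0 (ann k \<psi>) j + (\<Sum>l\<in>UNIV. if k = l then - \<alpha> l * \<psi> j else 0))"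
    unfolding gen_0_sum sum.distrib[symmetric]
    by (intro ext sum.cong refl) (simp add: algebra_simps)
  finally show ?thesis by (simp add: fun_eq_iff)
qed

lemma creb_gen_0: "creb k (gen \<alpha> 0 \<psi>) = gen \<alpha> 0 (creb k \<psi>)"
  unfolding gen_0_sum
  by (simp only: fin_op_sum_apply[OF fin_op_creb finite] fin_op_plus[OF fin_op_creb] fin_op_mult[OF fin_op_creb]
      creb_cre creb_ann)

lemma pump_gen_0: "pump \<alpha> (gen \<alpha> 0 \<psi>) = gen \<alpha> 0 (pump \<alpha> \<psi>)"
  unfolding pump_def
  by (simp only: creb_gen_0 fin_op_sum_apply[OF fin_op_gen finite] fin_op_mult[OF fin_op_gen])

lemma hop_gen_0: "hop (gen \<alpha> 0 \<psi>) = (\<lambda>j. gen \<alpha> 0 (hop \<psi>) j - pump \<alpha> \<psi> j)"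
  unfolding hop_def pump_def
  by (simp only: ann_gen_0 fin_op_diff[OF fin_op_creb] fin_op_mult[OF fin_op_creb] creb_gen_0
      fin_op_sum_apply[OF fin_op_gen finite] sum_subtractf)

lemma pump_gen_0_iter: "pump \<alpha> ((gen \<alpha> 0 ^^ n) \<psi>) = (gen \<alpha> 0 ^^ n) (pump \<alpha> \<psi>)"
  by (induction n) (simp_all add: pump_gen_0)

text \<open>Moving \<open>hop\<close> past n generators produces n commutators, all equal because
  \<open>pump\<close> commutes with the generator. For n = 0 the truncated exponent has coefficient
  zero.\<close>

lemma hop_gen_0_iter:
  "hop ((gen \<alpha> 0 ^^ n) \<psi>) = (\<lambda>j. (gen \<alpha> 0 ^^ n) (hop \<psi>) j - of_nat n * (gen \<alpha> 0 ^^ (n - 1)) (pump \<alpha> \<psi>) j)"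
proof (induction n)
  case (Suc n)
  have "gen \<alpha> 0 (\<lambda>j. of_nat n * (gen \<alpha> 0 ^^ (n - 1)) (pump \<alpha> \<psi>) j)
      = (\<lambda>j. of_nat n * (gen \<alpha> 0 ^^ n) (pump \<alpha> \<psi>) j)"
    by (cases n) (simp_all add: fin_op_mult[OF fin_op_gen] fin_op_zero[OF fin_op_gen])
  then show ?case
    by (simp add: hop_gen_0 Suc.IH fin_op_diff[OF fin_op_gen] pump_gen_0_iter algebra_simps)
qed simp

section \<open>Vectors in the LO vacuum\<close>

lemma vacuum_gen_0: "vacuum_LO \<psi> \<Longrightarrow> vacuum_LO (gen \<alpha> 0 \<psi>)"
  by (auto simp: vacuum_LO_def gen_0_sum cre_def ann_def intro!: sum.neutral)

lemma vacuum_gen_0_iter: "vacuum_LO \<psi> \<Longrightarrow> vacuum_LO ((gen \<alpha> 0 ^^ n) \<psi>)"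
  by (induction n) (simp_all add: vacuum_gen_0)

lemma annb_vacuum: "vacuum_LO \<psi> \<Longrightarrow> annb k \<psi> = (\<lambda>_. 0)"
proof -
  have "b(k := Suc (b k)) \<noteq> (\<lambda>_. 0)" for b :: "'a \<Rightarrow> nat" by (metis fun_upd_same nat.distinct(1))
  then show "vacuum_LO \<psi> \<Longrightarrow> annb k \<psi> = (\<lambda>_. 0)"
    by (auto simp: vacuum_LO_def annb_def fun_eq_iff)
qed

lemma gen_vacuum:
  assumes "vacuum_LO \<psi>"
  shows "gen \<alpha> \<delta> \<psi> = (\<lambda>j. gen \<alpha> 0 \<psi> j + \<delta> * (- \<i> * hop \<psi> j))"
  unfolding gen_sum hop_def sum_distrib_left sum.distrib[symmetric]
  by (intro ext sum.cong refl) (simp add: annb_vacuum[OF assms] fin_op_zero[OF fin_op_cre] algebra_simps)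

lemma annb_creb: "annb k (creb l \<psi>) = (\<lambda>j. creb l (annb k \<psi>) j + (if k = l then \<psi> j else 0))"
proof -
  have [simp]: "swap (swap \<phi>) = \<phi>" for \<phi> :: "('a, 'b) vec" by (simp add: swap_def fun_eq_iff)
  show ?thesis
    by (simp add: annb_swap creb_swap ann_cre) (auto simp: swap_def fun_eq_iff)
qed

text \<open>Pythagoras: single LO quanta in different modes are orthogonal. Moving
  \<open>creb k\<close> to the other side as \<open>annb k\<close> leaves a Kronecker delta, the
  remaining term being killed by the vacuum. It is used with u k = \<alpha>_k \<psi> and u k = a_k
  \<psi>.\<close>

lemma ip_creb_sum:
  fixes u :: "'n::finite \<Rightarrow> ('n, 'x) vec"
  assumes "\<And>k. finite_vec (u k)" "\<And>k. vacuum_LO (u k)"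
  shows "ip (\<lambda>j. \<Sum>k\<in>UNIV. creb k (u k) j) (\<lambda>j. \<Sum>k\<in>UNIV. creb k (u k) j) = (\<Sum>k\<in>UNIV. ip (u k) (u k))"
proof -
  have fin: "finite_vec (creb k (u l))" for k l by (rule fin_op_finite[OF fin_op_creb assms(1)])
  have "ip (creb k (u k)) (creb l (u l)) = (if k = l then ip (u k) (u k) else 0)" for k l
  proof -
    have "ip (creb k (u k)) (creb l (u l)) = ip (u k) (annb k (creb l (u l)))"
      by (rule adjD[OF adj_sym[OF adj_annb_creb] assms(1) fin])
    also have "annb k (creb l (u l)) = (\<lambda>j. if k = l then u l j else 0)"
      by (simp add: annb_creb annb_vacuum[OF assms(2)] fin_op_zero[OF fin_op_creb])
    finally show ?thesis by (simp add: ip_def)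
  qed
  then show ?thesis by (simp add: ip_sum_left ip_sum_right fin)
qed

lemma vacuum_ann: "vacuum_LO \<psi> \<Longrightarrow> vacuum_LO (ann k \<psi>)"
  by (simp add: vacuum_LO_def ann_def)

lemma vacuum_scale: "vacuum_LO \<psi> \<Longrightarrow> vacuum_LO (\<lambda>j. c * \<psi> j)"
  by (simp add: vacuum_LO_def)

lemma norm_pump:
  assumes "(\<Sum>k\<in>UNIV. (cmod (\<alpha> k))\<^sup>2) = 1" "finite_vec \<psi>" "vacuum_LO \<psi>"
  shows "norm (Abs_ell2 (pump \<alpha> \<psi>)) = norm (Abs_ell2 \<psi>)"
proof -
  have "ip (\<lambda>j. \<alpha> k * \<psi> j) (\<lambda>j. \<alpha> k * \<psi> j) = (cmod (\<alpha> k))\<^sup>2 * ip \<psi> \<psi>" for k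
    by (simp add: ip_def norm_mult power_mult_distrib infsum_cmult_right' flip: power2_norm_eq_inner)
  then have "(norm (Abs_ell2 (pump \<alpha> \<psi>)))\<^sup>2 = (\<Sum>k\<in>UNIV. (cmod (\<alpha> k))\<^sup>2 * ip \<psi> \<psi>)"
    using ip_creb_sum[of "\<lambda>k j. \<alpha> k * \<psi> j"] assms
    by (subst norm_Abs_sq[OF fin_op_finite[OF fin_op_pump assms(2)]])
      (simp add: finite_vec_scale vacuum_scale fin_op_mult[OF fin_op_creb] pump_def)
  also have "\<dots> = (norm (Abs_ell2 \<psi>))\<^sup>2"
    using assms by (simp add: norm_Abs_sq flip: sum_distrib_right)
  finally show ?thesis by (simp add: power2_eq_iff_nonneg)
qed

text \<open>Pythagoras reduces the squared norm to the expectations of a_k* a_k, which are diagonal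
  in the occupation number basis.\<close>

lemma norm_hop:
  assumes "finite_vec \<psi>" "vacuum_LO \<psi>"
  shows "ennreal ((norm (Abs_ell2 (hop \<psi>)))\<^sup>2) = n_tot_exp \<psi>"
proof -
  let ?S = "{j. \<psi> j \<noteq> 0}"
  have fin: "finite ?S" using assms(1) by (simp add: finite_vec_def)
  have num: "cre k (ann k \<psi>) = (\<lambda>j. of_nat (fst j k) * \<psi> j)" for k
  proof (rule ext)
    fix j :: "('a \<Rightarrow> nat) \<times> ('a \<Rightarrow> nat) \<times> 'b"
    obtain a b x where j: "j = (a, b, x)" by (cases j)
    show "cre k (ann k \<psi>) j = of_nat (fst j k) * \<psi> j"
      by (simp add: j ann_def cre_def sqrt_sqrt_mult)
  qed
  have "(norm (Abs_ell2 (hop \<psi>)))\<^sup>2 = (\<Sum>k\<in>UNIV. ip (ann k \<psi>) (ann k \<psi>))"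
    using ip_creb_sum[of "\<lambda>k. ann k \<psi>"] assms
    by (subst norm_Abs_sq[OF fin_op_finite[OF fin_op_hop assms(1)]])
      (simp add: fin_op_finite[OF fin_op_ann] vacuum_ann hop_def)
  also have "\<dots> = (\<Sum>k\<in>UNIV. ip \<psi> (cre k (ann k \<psi>)))"
    by (intro sum.cong refl adjD[OF adj_ann_cre] fin_op_finite[OF fin_op_ann] assms(1))
  also have "\<dots> = (\<Sum>k\<in>UNIV. \<Sum>j\<in>?S. real (fst j k) * (cmod (\<psi> j))\<^sup>2)"
    by (simp add: ip_finite[OF assms(1)] num power2_norm_eq_inner inner_complex_def algebra_simps)
  also have "\<dots> = (\<Sum>j\<in>?S. real (\<Sum>k\<in>UNIV. fst j k) * (cmod (\<psi> j))\<^sup>2)"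
    by (subst sum.swap) (simp add: sum_distrib_right)
  finally have "ennreal ((norm (Abs_ell2 (hop \<psi>)))\<^sup>2) = (\<Sum>j\<in>?S. ennreal (real (\<Sum>k\<in>UNIV. fst j k) * (cmod (\<psi> j))\<^sup>2))"
    by (simp add: sum_nonneg)
  also have "\<dots> = n_tot_exp \<psi>"
    unfolding n_tot_exp_def using fin by (subst nn_integral_count_space'[of ?S]) auto
  finally show ?thesis .
qed

section \<open>Distance between the two evolutions\<close>

lemma group_distance_finite:
  fixes \<psi> :: "('n::finite, 'x) vec"
  assumes \<alpha>: "(\<Sum>k\<in>UNIV. (cmod (\<alpha> k))\<^sup>2) = 1" and "0 \<le> \<delta>"
    and \<psi>: "finite_vec \<psi>" "vacuum_LO \<psi>"
    and U: "generated_group (qdop \<alpha> \<delta>) U" and U0: "generated_group (qdop \<alpha> 0) U0"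
  shows "norm (lift_group U s (Abs_ell2 \<psi>) - lift_group U0 s (Abs_ell2 \<psi>))
    \<le> \<delta> * (\<bar>s\<bar> * norm (Abs_ell2 (hop \<psi>)) + s\<^sup>2 / 2 * norm (Abs_ell2 \<psi>))"
proof -
  interpret entire_skew "fin_space :: (('n \<Rightarrow> nat) \<times> ('n \<Rightarrow> nat) \<times> 'x) ell2 set" "gen_ell2 \<alpha> 0"
    by (rule entire_skew_gen) simp
  \<comment> \<open>The locale has real scalars only, so the factor -i in front of T and \<beta> is
    absorbed into the vectors.\<close>
  let ?a = "\<lambda>j. - \<i> * hop \<psi> j" and ?b = "\<lambda>j. - \<i> * pump \<alpha> \<psi> j"
  have fin: "finite_vec (hop \<psi>)" "finite_vec (pump \<alpha> \<psi>)"
    using \<psi>(1) by (simp_all add: fin_op_finite[OF fin_op_hop] fin_op_finite[OF fin_op_pump])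
  then have fin': "finite_vec ?a" "finite_vec ?b" by (intro finite_vec_scale; simp)+
  have norms: "norm (Abs_ell2 ?a) = norm (Abs_ell2 (hop \<psi>))" "norm (Abs_ell2 ?b) = norm (Abs_ell2 \<psi>)"
    using norm_pump[OF \<alpha> \<psi>] fin by (simp_all only: Abs_scale finite_vec_in_l2 norm_cscale) simp_all
  have deriv: "((\<lambda>t. lift_group W t ((gen_ell2 \<alpha> 0 ^^ j) (Abs_ell2 \<psi>))) has_vector_derivative
      Abs_ell2 (gen \<alpha> \<epsilon> ((gen \<alpha> 0 ^^ j) \<psi>))) (at 0)"
    if "generated_group (qdop \<alpha> \<epsilon>) W" for W \<epsilon> j
    using lift_group_deriv[OF that finite_vec_gen_iter[OF \<psi>(1)]] by (simp add: gen_ell2_iter \<psi>(1))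
  have C: "Abs_ell2 (gen \<alpha> \<epsilon> ((gen \<alpha> 0 ^^ j) \<psi>)) = (gen_ell2 \<alpha> 0 ^^ Suc j) (Abs_ell2 \<psi>)
      + \<epsilon> *\<^sub>R ((gen_ell2 \<alpha> 0 ^^ j) (Abs_ell2 ?a) - real j *\<^sub>R (gen_ell2 \<alpha> 0 ^^ (j - 1)) (Abs_ell2 ?b))"
    for j \<epsilon>
  proof (rule coord_inject[THEN iffD1], rule ext)
    fix i
    note iter_fin = finite_vec_gen_iter[OF \<psi>(1)] finite_vec_gen_iter[OF fin'(1)] finite_vec_gen_iter[OF fin'(2)]
    have a: "(gen \<alpha> 0 ^^ m) (\<lambda>j. - \<i> * \<phi> j) = (\<lambda>j. - \<i> * (gen \<alpha> 0 ^^ m) \<phi> j)" for m and \<phi> :: "('n, 'x) vec"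
      by (rule fin_op_mult[OF fin_op_funpow[OF fin_op_gen]])
    have "coord (Abs_ell2 (gen \<alpha> \<epsilon> ((gen \<alpha> 0 ^^ j) \<psi>))) i = gen \<alpha> \<epsilon> ((gen \<alpha> 0 ^^ j) \<psi>) i"
      by (simp add: coord_finite_vec fin_op_finite[OF fin_op_gen] iter_fin)
    also have "\<dots> = gen \<alpha> 0 ((gen \<alpha> 0 ^^ j) \<psi>) i + \<epsilon> * (- \<i> *
        ((gen \<alpha> 0 ^^ j) (hop \<psi>) i - of_nat j * (gen \<alpha> 0 ^^ (j - 1)) (pump \<alpha> \<psi>) i))"
      by (simp only: gen_vacuum[OF vacuum_gen_0_iter[OF \<psi>(2)], of _ \<epsilon>] hop_gen_0_iter)
    also have "\<dots> = coord ((gen_ell2 \<alpha> 0 ^^ Suc j) (Abs_ell2 \<psi>)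
      + \<epsilon> *\<^sub>R ((gen_ell2 \<alpha> 0 ^^ j) (Abs_ell2 ?a) - real j *\<^sub>R (gen_ell2 \<alpha> 0 ^^ (j - 1)) (Abs_ell2 ?b))) i"
      using iter_fin(1)[where n = "Suc j"]
      by (simp only: gen_ell2_iter \<psi> fin' plus_ell2.rep_eq minus_ell2.rep_eq scaleR_ell2.rep_eq
          coord_finite_vec iter_fin a finite_vec_scale finite_vec_gen_iter fin) (simp add: algebra_simps)
    finally show "coord (Abs_ell2 (gen \<alpha> \<epsilon> ((gen \<alpha> 0 ^^ j) \<psi>))) i
      = coord ((gen_ell2 \<alpha> 0 ^^ Suc j) (Abs_ell2 \<psi>)
      + \<epsilon> *\<^sub>R ((gen_ell2 \<alpha> 0 ^^ j) (Abs_ell2 ?a) - real j *\<^sub>R (gen_ell2 \<alpha> 0 ^^ (j - 1)) (Abs_ell2 ?b))) i" .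
  qed
  have *: "norm (lift_group W s (Abs_ell2 \<psi>) - V s (Abs_ell2 \<psi>))
      \<le> \<epsilon> * (\<bar>s\<bar> * norm (Abs_ell2 ?a) + s\<^sup>2 / 2 * norm (Abs_ell2 ?b))"
    if W: "generated_group (qdop \<alpha> \<epsilon>) W" and "0 \<le> \<epsilon>" for W \<epsilon>
    using linear_lift_group[OF W] norm_lift_group[OF W] lift_group_add[OF W] lift_group_0[OF W] deriv[OF W] C
    by (rule duhamel) (intro Abs_in_fin_space \<psi> fin' that)+
  \<comment> \<open>The estimate with coupling 0 has right-hand side 0, so it also yields the
    uniqueness that identifies the chosen unperturbed group with the series.\<close>
  have "lift_group U0 s (Abs_ell2 \<psi>) = V s (Abs_ell2 \<psi>)" using *[OF U0] by simp
  then show ?thesis using *[OF U \<open>0 \<le> \<delta>\<close>] by (simp only: norms)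
qed

lemma n_tot_exp_restrict_le: "n_tot_exp (restrict_vec F \<psi>) \<le> n_tot_exp \<psi>"
  unfolding n_tot_exp_def restrict_vec_def by (intro nn_integral_mono) auto

text \<open>Truncations of \<psi> satisfy the finite bound with the same n and with norm at most 1;
  isometry makes the passage to \<psi> uniform.\<close>

lemma group_distance:
  fixes \<psi> :: "('n::finite, 'x) vec"
  assumes \<alpha>: "(\<Sum>k\<in>UNIV. (cmod (\<alpha> k))\<^sup>2) = 1" and "0 \<le> \<delta>"
    and \<psi>: "l2sq \<psi> = 1" "vacuum_LO \<psi>" "n_tot_exp \<psi> = ennreal n" "0 \<le> n"
    and U: "generated_group (qdop \<alpha> \<delta>) U" and U0: "generated_group (qdop \<alpha> 0) U0"
  shows "(l2norm (\<lambda>j. U s \<psi> j - U0 s \<psi> j))\<^sup>2 \<le> \<delta>\<^sup>2 * (2 * s\<^sup>2 * n + s ^ 4 / 2)"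
proof -
  have l2: "in_l2 \<psi>" using \<psi>(1) by (simp add: in_l2_def)
  define x where "x = Abs_ell2 \<psi>"
  have x: "coord x = \<psi>" using l2 by (simp add: x_def coord_Abs)
  have "norm x = 1" using norm_l2sq[of x] \<psi>(1) power2_eq_iff_nonneg[of "norm x" 1] by (simp add: x)
  let ?d = "\<lambda>y. lift_group U s y - lift_group U0 s y"
  let ?R = "\<delta> * (\<bar>s\<bar> * sqrt n + s\<^sup>2 / 2)"
  have "norm (?d x) \<le> ?R + e" if "0 < e" for e
  proof -
    \<comment> \<open>The truncation error enters once through each of the two groups, hence
      e/2.\<close>
    obtain F where F: "finite F" "norm (Abs_ell2 (restrict_vec F \<psi>) - x) < e / 2"
      "norm (Abs_ell2 (restrict_vec F \<psi>)) \<le> 1"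
      using restrict_approx[of "e / 2" x] \<open>0 < e\<close> \<open>norm x = 1\<close> x by auto
    let ?\<phi> = "restrict_vec F \<psi>"
    let ?y = "Abs_ell2 ?\<phi>"
    have vac: "vacuum_LO ?\<phi>" using \<psi>(2) by (simp add: vacuum_LO_def restrict_vec_def)
    have "ennreal ((norm (Abs_ell2 (hop ?\<phi>)))\<^sup>2) \<le> ennreal n"
      using norm_hop[OF finite_vec_restrict[OF F(1)] vac] n_tot_exp_restrict_le[of F \<psi>] \<psi>(3) by simp
    then have "norm (Abs_ell2 (hop ?\<phi>)) \<le> sqrt n"
      using \<psi>(4) by (simp add: real_le_rsqrt)
    then have "norm (?d ?y) \<le> ?R"
      using F(3) \<open>0 \<le> \<delta>\<close> mult_left_mono[OF F(3), of "s\<^sup>2 / 2"]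
      by (intro order_trans[OF group_distance_finite[OF \<alpha> \<open>0 \<le> \<delta>\<close> finite_vec_restrict[OF F(1)] vac U U0]])
        (intro mult_left_mono add_mono, auto)
    moreover have "norm (?d x - ?d ?y) \<le> norm (x - ?y) + norm (x - ?y)"
    proof -
      have "?d x - ?d ?y = lift_group U s (x - ?y) - lift_group U0 s (x - ?y)"
        by (simp add: linear_diff[OF linear_lift_group[OF U]] linear_diff[OF linear_lift_group[OF U0]])
      then show ?thesis
        using norm_triangle_ineq4[of "lift_group U s (x - ?y)" "lift_group U0 s (x - ?y)"]
        by (simp add: norm_lift_group[OF U] norm_lift_group[OF U0])
    qed
    ultimately show ?thesis
      using F(2) norm_triangle_sub[of "?d x" "?d ?y"] by (simp add: norm_minus_commute)
  qed
  then have le: "norm (?d x) \<le> ?R" by (rule field_le_epsilon)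
  have "l2norm (\<lambda>j. U s \<psi> j - U0 s \<psi> j) = norm (?d x)"
    by (simp add: coord_lift_group[OF U] coord_lift_group[OF U0] x minus_ell2.rep_eq flip: l2norm_coord)
  then have "(l2norm (\<lambda>j. U s \<psi> j - U0 s \<psi> j))\<^sup>2 \<le> ?R\<^sup>2"
    using le by (simp add: power_mono)
  also have "\<dots> = \<delta>\<^sup>2 * (\<bar>s\<bar> * sqrt n + s\<^sup>2 / 2)\<^sup>2" by (simp add: power_mult_distrib)
  also have "\<dots> \<le> \<delta>\<^sup>2 * (2 * s\<^sup>2 * n + s ^ 4 / 2)"
  proof (rule mult_left_mono)
    have "(\<bar>s\<bar> * sqrt n + s\<^sup>2 / 2)\<^sup>2 \<le> 2 * (\<bar>s\<bar> * sqrt n)\<^sup>2 + 2 * (s\<^sup>2 / 2)\<^sup>2"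
      using zero_le_power2[of "\<bar>s\<bar> * sqrt n - s\<^sup>2 / 2"] by (simp add: power2_sum power2_diff)
    also have "\<dots> = 2 * s\<^sup>2 * n + s ^ 4 / 2"
      using \<psi>(4) by (simp add: power_mult_distrib power_divide power_even_abs flip: power_mult)
    finally show "(\<bar>s\<bar> * sqrt n + s\<^sup>2 / 2)\<^sup>2 \<le> 2 * s\<^sup>2 * n + s ^ 4 / 2" .
  qed simp
  finally show ?thesis .
qed

section \<open>Integration over the apparatus variable\<close>

lemma generated_group_0: "generated_group A U \<Longrightarrow> in_l2 \<psi> \<Longrightarrow> U 0 \<psi> = \<psi>"
  by (simp add: generated_group_def)

lemma l2norm_zero: "l2norm (\<lambda>j. 0) = 0"
  by (simp add: l2norm_def l2sq_def)

lemma ennreal_weighted_sum: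
  assumes "0 \<le> a" "0 \<le> b" "0 \<le> n" "0 \<le> d"
  shows "ennreal (d * (2 * a * n + b / 2)) = ennreal d * (2 * ennreal a * ennreal n + ennreal b / 2)"
proof -
  have "ennreal (b / 2) = ennreal b / 2"
    using divide_ennreal[of b 2] assms by simp
  moreover have "ennreal (2 * a * n) = 2 * ennreal a * ennreal n"
    using assms by (simp add: ennreal_mult)
  ultimately show ?thesis using assms by (simp add: ennreal_mult ennreal_plus)
qed

theorem theorem4:
  fixes \<alpha> :: "'n::finite \<Rightarrow> complex"
    and \<delta> :: real
    and \<mu> :: "real measure"
    and g :: "real \<Rightarrow> complex"
    and \<psi> :: "('n, 'x) vec"
  assumes alpha_norm: "(\<Sum>k\<in>UNIV. (cmod (\<alpha> k))\<^sup>2) = 1"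
    and delta_nonneg: "\<delta> \<ge> 0"
    and mu_borel: "sets \<mu> = sets borel"
    and g_meas: "g \<in> borel_measurable \<mu>"
    and g_norm: "(\<integral>\<^sup>+ s. ennreal ((cmod (g s))\<^sup>2) \<partial>\<mu>) = 1"
    and psi_norm: "l2sq \<psi> = 1"
    and psi_vac: "vacuum_LO \<psi>"
  shows "phi_dist_sq \<alpha> \<delta> \<mu> g \<psi>
    \<le> ennreal (\<delta>\<^sup>2) * (2 * bmom \<mu> g 1 * n_tot_exp \<psi>
        + ennreal (\<delta>\<^sup>2 / 9) * bmom \<mu> g 3 * q2_exp \<alpha> \<psi>
        + bmom \<mu> g 2 / 2)"
proof -
  let ?U = "exp_group (qdop \<alpha> \<delta>) :: real \<Rightarrow> ('n, 'x) vec \<Rightarrow> _"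
    and ?W = "exp_group (qdop \<alpha> 0) :: real \<Rightarrow> ('n, 'x) vec \<Rightarrow> _"
  have U: "generated_group (qdop \<alpha> \<delta>) ?U" "generated_group (qdop \<alpha> 0) ?W"
    using delta_nonneg by (simp_all add: exp_group_generated)
  have [measurable_cong]: "sets \<mu> = sets borel" by (rule mu_borel)
  note [measurable] = g_meas
  have id_meas [measurable]: "(\<lambda>s. s) \<in> borel_measurable \<mu>"
    using mu_borel by (simp cong: measurable_cong_sets)
  \<comment> \<open>An infinite expectation makes the bound infinite unless it is multiplied by
    zero, the product of 0 and \<infinity> being 0 in \<open>ennreal\<close>. The cases \<delta> = 0
    and b_{g,2} = 0 are therefore separate, and in them the distance itself vanishes.\<close>
  consider n where "0 \<le> n" "n_tot_exp \<psi> = ennreal n" | "\<delta> = 0" | "bmom \<mu> g 1 = 0"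
    | "\<delta> \<noteq> 0" "bmom \<mu> g 1 \<noteq> 0" "n_tot_exp \<psi> = \<infinity>"
    by (cases "n_tot_exp \<psi>") auto
  then show ?thesis
  proof cases
    case (1 n)
    \<comment> \<open>The comparison is pointwise in s, so measurability is asked only of the
      explicit integrand on the right.\<close>
    have "phi_dist_sq \<alpha> \<delta> \<mu> g \<psi> \<le> (\<integral>\<^sup>+ s. ennreal (\<delta>\<^sup>2) * (2 * ennreal (s ^ (2 * 1) * (cmod (g s))\<^sup>2) * ennreal n
        + ennreal (s ^ (2 * 2) * (cmod (g s))\<^sup>2) / 2) \<partial>\<mu>)"
      unfolding phi_dist_sq_def
    proof (rule nn_integral_mono)
      fix s
      have "(cmod (g s))\<^sup>2 * (l2norm (\<lambda>j. ?U s \<psi> j - ?W s \<psi> j))\<^sup>2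
        \<le> (cmod (g s))\<^sup>2 * (\<delta>\<^sup>2 * (2 * s\<^sup>2 * n + s ^ 4 / 2))"
        by (intro mult_left_mono group_distance[OF alpha_norm delta_nonneg psi_norm psi_vac 1(2,1) U]) simp
      also have "\<dots> = \<delta>\<^sup>2 * (2 * (s ^ (2 * 1) * (cmod (g s))\<^sup>2) * n + (s ^ (2 * 2) * (cmod (g s))\<^sup>2) / 2)"
        by (simp add: algebra_simps power2_eq_square)
      finally have "ennreal ((cmod (g s))\<^sup>2 * (l2norm (\<lambda>j. ?U s \<psi> j - ?W s \<psi> j))\<^sup>2)
        \<le> ennreal (\<delta>\<^sup>2 * (2 * (s ^ (2 * 1) * (cmod (g s))\<^sup>2) * n + (s ^ (2 * 2) * (cmod (g s))\<^sup>2) / 2))"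
        by (rule ennreal_leI)
      also have "\<dots> = ennreal (\<delta>\<^sup>2) * (2 * ennreal (s ^ (2 * 1) * (cmod (g s))\<^sup>2) * ennreal n
        + ennreal (s ^ (2 * 2) * (cmod (g s))\<^sup>2) / 2)"
        using 1(1) by (intro ennreal_weighted_sum) auto
      finally show "ennreal ((cmod (g s))\<^sup>2 * (l2norm (\<lambda>j. ?U s \<psi> j - ?W s \<psi> j))\<^sup>2) \<le> \<dots>" .
    qed
    also have "\<dots> = ennreal (\<delta>\<^sup>2) * (2 * bmom \<mu> g 1 * n_tot_exp \<psi> + bmom \<mu> g 2 / 2)"
      unfolding bmom_def 1(2)
      by (simp add: nn_integral_add nn_integral_cmult nn_integral_multc nn_integral_divide)
    also have "\<dots> \<le> ennreal (\<delta>\<^sup>2) * (2 * bmom \<mu> g 1 * n_tot_exp \<psi>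
        + ennreal (\<delta>\<^sup>2 / 9) * bmom \<mu> g 3 * q2_exp \<alpha> \<psi> + bmom \<mu> g 2 / 2)"
      by (intro mult_left_mono add_right_mono) auto
    finally show ?thesis .
  next
    case 2
    then show ?thesis by (simp add: phi_dist_sq_def l2norm_zero)
  next
    case 3
    then have "AE s in \<mu>. ennreal (s ^ (2 * 1) * (cmod (g s))\<^sup>2) = 0"
      unfolding bmom_def by (subst (asm) nn_integral_0_iff_AE) simp_all
    \<comment> \<open>A vanishing second moment concentrates |g|^2 at s = 0, where both groups are
      the identity.\<close>
    then have "AE s in \<mu>. ennreal ((cmod (g s))\<^sup>2 * (l2norm (\<lambda>j. ?U s \<psi> j - ?W s \<psi> j))\<^sup>2) = 0"
    proof eventually_elim
      case (elim s)
      have "in_l2 \<psi>" using psi_norm by (simp add: in_l2_def)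
      then have "?U 0 \<psi> = \<psi>" "?W 0 \<psi> = \<psi>" by (simp_all only: generated_group_0[OF U(1)] generated_group_0[OF U(2)])
      moreover from elim have "s = 0 \<or> g s = 0" by (auto simp: ennreal_eq_0_iff mult_le_0_iff)
      ultimately show ?case by (auto simp: l2norm_zero)
    qed
    then have "phi_dist_sq \<alpha> \<delta> \<mu> g \<psi> = (\<integral>\<^sup>+ s. 0 \<partial>\<mu>)"
      unfolding phi_dist_sq_def by (rule nn_integral_cong_AE)
    then show ?thesis by simp
  next
    case 4
    then show ?thesis by (simp add: ennreal_mult_top ennreal_top_mult)
  qed
qed

end
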